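(* Assume $\mathsf{SRP}$. Let $K$ be a set of regular cardinals with $\min(K)>\omega_1$, and let $\vec S=\langle S_{\kappa,i}:\kappa\in K,i<\omega_1\rangle$ be such that each $S_{\kappa,i}$ is a subset of $S^\kappa_\omega$ stationary in $\kappa$. For $\kappa\in K$ let $\vec S_\kappa=\langle S_{\kappa,i}:i<\omega_1\rangle$. Then the sequence $\langle\mathrm{eTr}(\vec S_\kappa):\kappa\in K\rangle$ is mutually stationary.
   Context: $S^\kappa_\omega=\{\xi<\kappa:\mathrm{cf}\xi=\omega\}$. For a sequence $\vec S=\langle S_i:i<\lambda\rangle$ of stationary subsets of $\kappa$, an exact simultaneous reflection point is an ordinal $\delta<\kappa$ of uncountable cofinality such that $S_i\cap\delta$ is stationary in $\delta$ for every $i<\lambda$ and $\delta\cap\bigcup_{i<\lambda}S_i$ contains a club in $\delta$; $\mathrm{eTr}(\vec S)$ is the set of these. A sequence $\langle T_\kappa:\kappa\in K\rangle$ with $T_\kappa\subseteq\kappa$, $K$ a set of regular cardinals with supremum $\delta$, is mutually stationary if for every algebra $\mathcal{A}$ on $\delta$ there is $N\prec\mathcal{A}$ with $\sup(N\cap\kappa)\in T_\kappa$ for all $\kappa\in N\cap K$. $\mathsf{SRP}$: for every regular $\kappa\ge\omega_2$, every projective stationary $S\subseteq[H_\kappa]^\omega$ (i.e. $\{X\in S:X\cap\omega_1\in T\}$ is stationary for every stationary $T\subseteq\omega_1$) contains a continuous $\in$-chain of length $\omega_1$ (an $\in$-increasing sequence of members of $S$ with unions at limits). *)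

theory Defs
  imports Main "HOL-Library.Countable_Set" "HOL-Library.Equipollence"
begin

text \<open>
  The set-theoretic universe is an arbitrary type of class \<open>zfc\<close>, where \<open>elts x\<close> is the class of
  members of the set \<open>x\<close>. Classes are HOL sets and class functions are HOL functions, so separation
  and replacement are stated in second-order form. Choice is inherited from HOL.
  Subsets of a set, and functions on a set, can therefore be given as HOL sets and HOL functions.
\<close>

class zfc =
  fixes elts :: "'a \<Rightarrow> 'a set"
  assumes extensionality: "elts x = elts y \<Longrightarrow> x = y"
    and foundation: "wf {(x, y). x \<in> elts y}"
    and pairing: "\<exists>z. elts z = {x, y}"
    and union: "\<exists>z. elts z = (\<Union>y\<in>elts x. elts y)"
    and power_set: "\<exists>z. elts z = {y. elts y \<subseteq> elts x}"
    and infinity: "\<exists>w. (\<exists>e\<in>elts w. elts e = {}) \<and>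
                       (\<forall>y\<in>elts w. \<exists>z\<in>elts w. elts z = insert y (elts y))"
    and separation: "\<exists>z. elts z = {y \<in> elts x. P y}"
    and replacement: "\<exists>z. elts z = F ` elts x"

definition set_of :: "'v::zfc set \<Rightarrow> 'v" where
  "set_of A = (THE x. elts x = A)"

subsection \<open>Ordinals, cardinals and cofinality\<close>

text \<open>Von Neumann ordinals: \<open>\<alpha> < \<beta>\<close> is \<open>\<alpha> \<in> elts \<beta>\<close> and \<open>\<alpha> \<le> \<beta>\<close> is \<open>elts \<alpha> \<subseteq> elts \<beta>\<close>.\<close>

definition transitive_set :: "'v::zfc \<Rightarrow> bool" where
  "transitive_set x \<longleftrightarrow> (\<forall>y\<in>elts x. elts y \<subseteq> elts x)"

definition Ord :: "'v::zfc \<Rightarrow> bool" where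
  "Ord \<alpha> \<longleftrightarrow> transitive_set \<alpha> \<and> (\<forall>\<beta>\<in>elts \<alpha>. transitive_set \<beta>)"

definition limit_ord :: "'v::zfc \<Rightarrow> bool" where
  "limit_ord \<alpha> \<longleftrightarrow> Ord \<alpha> \<and> elts \<alpha> \<noteq> {} \<and> (\<forall>\<beta>\<in>elts \<alpha>. \<exists>\<gamma>\<in>elts \<alpha>. \<beta> \<in> elts \<gamma>)"

definition least_ord :: "('v::zfc \<Rightarrow> bool) \<Rightarrow> 'v" where
  "least_ord P = (THE \<alpha>. Ord \<alpha> \<and> P \<alpha> \<and> (\<forall>\<beta>\<in>elts \<alpha>. \<not> P \<beta>))"

text \<open>For a small class of ordinals the union is the supremum.\<close>

definition sup_ord :: "'v::zfc set \<Rightarrow> 'v" where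
  "sup_ord A = set_of (\<Union>\<alpha>\<in>A. elts \<alpha>)"

definition omega :: "'v::zfc" where
  "omega = least_ord (\<lambda>\<alpha>. infinite (elts \<alpha>))"

definition card_succ :: "'v::zfc \<Rightarrow> 'v" where
  "card_succ \<alpha> = least_ord (\<lambda>\<beta>. elts \<alpha> \<prec> elts \<beta>)"

definition omega1 :: "'v::zfc" where
  "omega1 = card_succ omega"

definition omega2 :: "'v::zfc" where
  "omega2 = card_succ omega1"

definition cofinal_in :: "'v::zfc set \<Rightarrow> 'v \<Rightarrow> bool" where
  "cofinal_in A \<delta> \<longleftrightarrow> A \<subseteq> elts \<delta> \<and> (\<forall>\<alpha>\<in>elts \<delta>. \<exists>\<beta>\<in>A. elts \<alpha> \<subseteq> elts \<beta>)"

definition cf :: "'v::zfc \<Rightarrow> 'v" where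
  "cf \<delta> = least_ord (\<lambda>\<beta>. \<exists>f :: 'v \<Rightarrow> 'v. cofinal_in (f ` elts \<beta>) \<delta>)"

definition cardinal :: "'v::zfc \<Rightarrow> bool" where
  "cardinal \<kappa> \<longleftrightarrow> Ord \<kappa> \<and> (\<forall>\<alpha>\<in>elts \<kappa>. \<not> elts \<alpha> \<approx> elts \<kappa>)"

definition regular_cardinal :: "'v::zfc \<Rightarrow> bool" where
  "regular_cardinal \<kappa> \<longleftrightarrow> cardinal \<kappa> \<and> infinite (elts \<kappa>) \<and> cf \<kappa> = \<kappa>"

subsection \<open>Clubs and stationary sets of ordinals\<close>

definition club_in :: "'v::zfc set \<Rightarrow> 'v \<Rightarrow> bool" where
  "club_in C \<delta> \<longleftrightarrow> cofinal_in C \<delta> \<and>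
     (\<forall>\<alpha>\<in>elts \<delta>. limit_ord \<alpha> \<and> cofinal_in (C \<inter> elts \<alpha>) \<alpha> \<longrightarrow> \<alpha> \<in> C)"

definition stationary_in :: "'v::zfc set \<Rightarrow> 'v \<Rightarrow> bool" where
  "stationary_in S \<delta> \<longleftrightarrow> S \<subseteq> elts \<delta> \<and> (\<forall>C. club_in C \<delta> \<longrightarrow> S \<inter> C \<noteq> {})"

definition S_cof_omega :: "'v::zfc \<Rightarrow> 'v set" where
  "S_cof_omega \<kappa> = {\<xi> \<in> elts \<kappa>. cf \<xi> = omega}"

text \<open>\<open>eTr \<kappa> l S\<close>: exact simultaneous reflection points of the sequence \<open>S i\<close>, \<open>i < l\<close>, of subsets
  of \<open>\<kappa>\<close>.\<close>

definition eTr :: "'v::zfc \<Rightarrow> 'v \<Rightarrow> ('v \<Rightarrow> 'v set) \<Rightarrow> 'v set" where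
  "eTr \<kappa> l S = {\<delta> \<in> elts \<kappa>. omega \<in> elts (cf \<delta>) \<and>
     (\<forall>i\<in>elts l. stationary_in (S i \<inter> elts \<delta>) \<delta>) \<and>
     (\<exists>C. club_in C \<delta> \<and> C \<subseteq> elts \<delta> \<inter> (\<Union>i\<in>elts l. S i))}"

subsection \<open>Algebras, elementary substructures and mutual stationarity\<close>

text \<open>
  Structures for a countable first-order language. Symbols are identified by a natural number
  together with the length of the argument list, so there are countably many function and relation
  symbols of each finite arity and every term is well formed.
\<close>

datatype tm = Var nat | App nat "tm list"

datatype fm = Eq tm tm | Rel nat "tm list" | Neg fm | Conj fm fm | Exists nat fm

record 'a algebra =
  univ :: "'a set"
  opn :: "nat \<Rightarrow> 'a list \<Rightarrow> 'a"
  rel :: "nat \<Rightarrow> 'a list \<Rightarrow> bool"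

primrec eval_tm :: "'a algebra \<Rightarrow> (nat \<Rightarrow> 'a) \<Rightarrow> tm \<Rightarrow> 'a" where
  "eval_tm A s (Var n) = s n"
| "eval_tm A s (App f ts) = opn A f (map (eval_tm A s) ts)"

primrec sat :: "'a algebra \<Rightarrow> (nat \<Rightarrow> 'a) \<Rightarrow> fm \<Rightarrow> bool" where
  "sat A s (Eq t u) \<longleftrightarrow> eval_tm A s t = eval_tm A s u"
| "sat A s (Rel r ts) \<longleftrightarrow> rel A r (map (eval_tm A s) ts)"
| "sat A s (Neg p) \<longleftrightarrow> \<not> sat A s p"
| "sat A s (Conj p q) \<longleftrightarrow> sat A s p \<and> sat A s q"
| "sat A s (Exists n p) \<longleftrightarrow> (\<exists>x\<in>univ A. sat A (s(n := x)) p)"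

definition is_algebra :: "'a algebra \<Rightarrow> bool" where
  "is_algebra A \<longleftrightarrow> univ A \<noteq> {} \<and> (\<forall>f xs. set xs \<subseteq> univ A \<longrightarrow> opn A f xs \<in> univ A)"

definition elem_sub :: "'a set \<Rightarrow> 'a algebra \<Rightarrow> bool" where
  "elem_sub N A \<longleftrightarrow> N \<subseteq> univ A \<and> is_algebra (A\<lparr>univ := N\<rparr>) \<and>
     (\<forall>p s. range s \<subseteq> N \<longrightarrow> (sat (A\<lparr>univ := N\<rparr>) s p \<longleftrightarrow> sat A s p))"

definition mutually_stationary :: "'v::zfc \<Rightarrow> ('v \<Rightarrow> 'v set) \<Rightarrow> bool" where
  "mutually_stationary K T \<longleftrightarrow>
     (\<forall>\<kappa>\<in>elts K. regular_cardinal \<kappa> \<and> T \<kappa> \<subseteq> elts \<kappa>) \<and>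
     (\<forall>A. is_algebra A \<and> univ A = elts (sup_ord (elts K)) \<longrightarrow>
        (\<exists>N. elem_sub N A \<and> (\<forall>\<kappa>\<in>N \<inter> elts K. sup_ord (N \<inter> elts \<kappa>) \<in> T \<kappa>)))"

subsection \<open>The strong reflection principle\<close>

text \<open>Subclasses of \<open>[A]\<^sup>\<omega>\<close> are given as HOL sets of elements of the universe.\<close>

definition ctbl_subsets :: "'v::zfc set \<Rightarrow> 'v set" where
  "ctbl_subsets A = {x. elts x \<subseteq> A \<and> countable (elts x) \<and> infinite (elts x)}"

definition club_ctbl :: "'v::zfc set \<Rightarrow> 'v set \<Rightarrow> bool" where
  "club_ctbl C A \<longleftrightarrow> C \<subseteq> ctbl_subsets A \<and>
     (\<forall>x\<in>ctbl_subsets A. \<exists>y\<in>C. elts x \<subseteq> elts y) \<and>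
     (\<forall>x :: nat \<Rightarrow> 'v. (\<forall>n. x n \<in> C \<and> elts (x n) \<subseteq> elts (x (Suc n))) \<longrightarrow>
        set_of (\<Union>n. elts (x n)) \<in> C)"

definition stationary_ctbl :: "'v::zfc set \<Rightarrow> 'v set \<Rightarrow> bool" where
  "stationary_ctbl S A \<longleftrightarrow> S \<subseteq> ctbl_subsets A \<and> (\<forall>C. club_ctbl C A \<longrightarrow> S \<inter> C \<noteq> {})"

definition trcl_elts :: "'v::zfc \<Rightarrow> 'v set" where
  "trcl_elts x = {y. (y, x) \<in> {(a, b). a \<in> elts b}\<^sup>+}"

definition H :: "'v::zfc \<Rightarrow> 'v set" where
  "H \<kappa> = {x. trcl_elts x \<prec> elts \<kappa>}"

definition projective_stationary :: "'v::zfc set \<Rightarrow> 'v \<Rightarrow> bool" where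
  "projective_stationary S \<kappa> \<longleftrightarrow> S \<subseteq> ctbl_subsets (H \<kappa>) \<and>
     (\<forall>T. stationary_in T omega1 \<longrightarrow>
        stationary_ctbl {X \<in> S. set_of (elts X \<inter> elts omega1) \<in> T} (H \<kappa>))"

definition continuous_in_chain :: "('v::zfc \<Rightarrow> 'v) \<Rightarrow> 'v \<Rightarrow> bool" where
  "continuous_in_chain X l \<longleftrightarrow>
     (\<forall>\<beta>\<in>elts l. \<forall>\<alpha>\<in>elts \<beta>. X \<alpha> \<in> elts (X \<beta>)) \<and>
     (\<forall>\<beta>\<in>elts l. limit_ord \<beta> \<longrightarrow> elts (X \<beta>) = (\<Union>\<alpha>\<in>elts \<beta>. elts (X \<alpha>)))"

definition SRP :: "'v::zfc itself \<Rightarrow> bool" where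
  "SRP (_ :: 'v itself) \<longleftrightarrow>
     (\<forall>(\<kappa>::'v) S. regular_cardinal \<kappa> \<and> elts omega2 \<subseteq> elts \<kappa> \<and> projective_stationary S \<kappa> \<longrightarrow>
        (\<exists>X. continuous_in_chain X omega1 \<and> (\<forall>\<alpha>\<in>elts omega1. X \<alpha> \<in> S)))"

end

theory Submission imports Defs begin

text \<open>
  Partition \<open>\<omega>\<^sub>1\<close> into stationary sets \<open>D\<^sub>i\<close>, \<open>i < \<omega>\<^sub>1\<close>, such that every stationary set has stationary
  intersection with some \<open>D\<^sub>i\<close>. Consider the countable \<open>X \<subseteq> H\<^sub>\<theta>\<close>, closed under Skolem functions, such
  that \<open>sup (X \<inter> \<kappa>) \<in> S\<^sub>\<kappa>\<^sub>,\<^sub>i\<close> for all \<open>\<kappa> \<in> X \<inter> K\<close>, where \<open>X \<inter> \<omega>\<^sub>1 \<in> D\<^sub>i\<close>. They form a projective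
  stationary set: given a stationary \<open>T \<subseteq> D\<^sub>i\<close>, apply to \<open>T\<close> and the sets \<open>S\<^sub>\<kappa>\<^sub>,\<^sub>i\<close> the theorem of
  Foreman and Magidor that stationary sets of ordinals of countable cofinality are mutually
  stationary. If \<open>N\<close> is the union of a continuous \<open>\<in>\<close>-chain \<open>X\<^sub>\<alpha>\<close>, \<open>\<alpha> < \<omega>\<^sub>1\<close>, of such sets, then
  \<open>\<alpha> \<mapsto> sup (X\<^sub>\<alpha> \<inter> \<kappa>)\<close> is continuous and cofinal in \<open>sup (N \<inter> \<kappa>)\<close>. Its range is a club
  contained in the union of the \<open>S\<^sub>\<kappa>\<^sub>,\<^sub>i\<close>, and it meets each \<open>S\<^sub>\<kappa>\<^sub>,\<^sub>i\<close> in a stationary set because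
  \<open>X\<^sub>\<alpha> \<inter> \<omega>\<^sub>1 = \<alpha>\<close> for club many \<open>\<alpha>\<close>.
\<close>

section \<open>Sets and ordinals\<close>

text \<open>\<open>SRP\<close> yields one chain through one set of countable models, so the index i
  must be read off from X itself. X \<inter> \<omega>1 suits: its values along a chain increase
  continuously in \<omega>1 and agree with the identity on a club, so the chain visits each fibre
  stationarily often, and the same i serves all \<kappa> at once. That every stationary T has a
  stationary trace on some fibre is what allows projective stationarity. The hard part is the
  existence of one such X. It must meet the demands of all \<kappa> \<in> X \<inter> K, a countable
  set not known until X is built, and moving sup (X \<inter> \<kappa>) into place must not be undone
  when later cardinals are treated. Hence models are attached to the nodes of a tree, and thinning
  keeps unbounded branching at every cardinal not yet treated. That a suitable thinning exists is
  the determinacy of a game that is open for the player who tries to leave \<delta>; since winning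
  for him is an inductive predicate, infinite plays never appear. The set T is handled by treating
  \<omega>1 as one more cardinal.\<close>

definition small :: "'v::zfc set \<Rightarrow> bool" where
  "small A \<longleftrightarrow> (\<exists>z. elts z = A)"

lemma elts_set_of [simp]: "small A \<Longrightarrow> elts (set_of A) = A"
proof -
  assume "small A"
  then obtain z where z: "elts z = A" by (auto simp: small_def)
  then have "(THE x. elts x = A) = z"
    by (intro the_equality) (auto intro: extensionality)
  then show ?thesis using z by (simp add: set_of_def)
qed

lemma small_elts [simp]: "small (elts x)"
  by (auto simp: small_def)

lemma set_of_elts [simp]: "set_of (elts x) = x"
  by (rule extensionality) simp

lemma small_subset: "small B \<Longrightarrow> A \<subseteq> B \<Longrightarrow> small A"
proof -
  assume "small B" "A \<subseteq> B"
  then obtain z where z: "elts z = B" by (auto simp: small_def)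
  obtain y where "elts y = {u \<in> elts z. u \<in> A}" using separation[of z "\<lambda>u. u \<in> A"] by blast
  with z \<open>A \<subseteq> B\<close> have "elts y = A" by auto
  then show ?thesis by (auto simp: small_def)
qed

lemma small_image: "small A \<Longrightarrow> small (f ` A)" for f :: "'v::zfc \<Rightarrow> 'v"
  unfolding small_def using replacement by blast

lemma small_UN: "small (I :: 'v::zfc set) \<Longrightarrow> (\<And>i. i \<in> I \<Longrightarrow> small (B i :: 'v set)) \<Longrightarrow> small (\<Union>i\<in>I. B i)"
proof -
  assume I: "small I" and B: "\<And>i. i \<in> I \<Longrightarrow> small (B i)"
  obtain z where z: "elts z = (\<lambda>i. set_of (B i)) ` I"
    using small_image[OF I, of "\<lambda>i. set_of (B i)"] by (auto simp: small_def)
  obtain u where "elts u = (\<Union>y\<in>elts z. elts y)" using union by blast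
  with z B have "elts u = (\<Union>i\<in>I. B i)" by auto
  then show ?thesis by (auto simp: small_def)
qed

lemma small_insert: "small A \<Longrightarrow> small (insert x A)"
proof -
  assume A: "small A"
  obtain s where s: "elts s = {x, x}" using pairing by blast
  obtain p where p: "elts p = {s, set_of A}" using pairing by blast
  have "small (\<Union>y\<in>elts p. elts y)" by (rule small_UN) auto
  moreover have "(\<Union>y\<in>elts p. elts y) = insert x A" using p s A by auto
  ultimately show ?thesis by simp
qed

lemma small_lepoll: "small (B :: 'v::zfc set) \<Longrightarrow> A \<lesssim> B \<Longrightarrow> small (A :: 'v set)"
  unfolding lepoll_iff by (meson small_image small_subset)

lemma not_in_self: "x \<notin> elts x"
  using foundation wf_not_refl[of "{(x, y). x \<in> elts y}" x] by auto

lemma not_in_sym: "x \<in> elts y \<Longrightarrow> y \<notin> elts x"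
  using foundation wf_not_sym[of "{(x, y). x \<in> elts y}" x y] by auto

lemma elts_induct: "(\<And>x. (\<And>y. y \<in> elts x \<Longrightarrow> P y) \<Longrightarrow> P x) \<Longrightarrow> P x"
  using wf_induct[OF foundation, of P x] by auto

lemma Ord_in_Ord: "Ord \<alpha> \<Longrightarrow> \<beta> \<in> elts \<alpha> \<Longrightarrow> Ord \<beta>"
  unfolding Ord_def transitive_set_def by blast

lemma Ord_trans: "Ord \<alpha> \<Longrightarrow> \<beta> \<in> elts \<alpha> \<Longrightarrow> \<gamma> \<in> elts \<beta> \<Longrightarrow> \<gamma> \<in> elts \<alpha>"
  by (auto simp: Ord_def transitive_set_def)

lemma Ord_subset: "Ord \<alpha> \<Longrightarrow> \<beta> \<in> elts \<alpha> \<Longrightarrow> elts \<beta> \<subseteq> elts \<alpha>"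
  by (auto intro: Ord_trans)

lemma OrdI: "(\<And>\<beta>. \<beta> \<in> elts \<alpha> \<Longrightarrow> Ord \<beta>) \<Longrightarrow> (\<And>\<beta> \<gamma>. \<beta> \<in> elts \<alpha> \<Longrightarrow> \<gamma> \<in> elts \<beta> \<Longrightarrow> \<gamma> \<in> elts \<alpha>) \<Longrightarrow> Ord \<alpha>"
  unfolding Ord_def transitive_set_def by blast

lemma Ord_linear: "Ord \<alpha> \<Longrightarrow> Ord \<beta> \<Longrightarrow> \<alpha> \<in> elts \<beta> \<or> \<alpha> = \<beta> \<or> \<beta> \<in> elts \<alpha>"
proof (induction \<alpha> arbitrary: \<beta> rule: elts_induct)
  case (1 \<alpha>)
  note IHa = 1
  from \<open>Ord \<beta>\<close> show ?case
  proof (induction \<beta> rule: elts_induct)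
    case (1 \<beta>)
    show ?case
    proof (rule ccontr)
      assume *: "\<not> ?thesis"
      have "elts \<alpha> \<subseteq> elts \<beta>"
        using IHa(1)[OF _ Ord_in_Ord[OF IHa(2)] 1(2)] * Ord_in_Ord[OF IHa(2)] Ord_trans[OF IHa(2)]
        by (metis subsetI)
      moreover have "elts \<beta> \<subseteq> elts \<alpha>"
        using 1 * Ord_in_Ord[OF 1(2)] Ord_trans[OF 1(2)] by (metis subsetI)
      ultimately have "\<alpha> = \<beta>" by (intro extensionality) auto
      then show False using * by blast
    qed
  qed
qed

lemma Ord_subset_iff: "Ord \<alpha> \<Longrightarrow> Ord \<beta> \<Longrightarrow> elts \<alpha> \<subseteq> elts \<beta> \<longleftrightarrow> \<alpha> \<in> elts \<beta> \<or> \<alpha> = \<beta>"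
  using Ord_linear not_in_self Ord_subset by blast

lemma Ord_not_in_iff: "Ord \<alpha> \<Longrightarrow> Ord \<beta> \<Longrightarrow> \<alpha> \<notin> elts \<beta> \<longleftrightarrow> elts \<beta> \<subseteq> elts \<alpha>"
  using Ord_linear Ord_subset_iff not_in_sym by (metis not_in_self)

lemma Ord_le_in_trans: "Ord \<gamma> \<Longrightarrow> Ord \<alpha> \<Longrightarrow> elts \<alpha> \<subseteq> elts \<beta> \<Longrightarrow> \<beta> \<in> elts \<gamma> \<Longrightarrow> \<alpha> \<in> elts \<gamma>"
  by (metis Ord_in_Ord Ord_subset_iff Ord_trans)

lemma Ord_Union: "small A \<Longrightarrow> (\<And>\<alpha>. \<alpha> \<in> A \<Longrightarrow> Ord \<alpha>) \<Longrightarrow>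
    elts (sup_ord A) = (\<Union>\<alpha>\<in>A. elts \<alpha>) \<and> Ord (sup_ord A)"
proof -
  assume A: "small A" "\<And>\<alpha>. \<alpha> \<in> A \<Longrightarrow> Ord \<alpha>"
  have e: "elts (sup_ord A) = (\<Union>\<alpha>\<in>A. elts \<alpha>)"
    unfolding sup_ord_def by (intro elts_set_of small_UN A) auto
  moreover have "Ord (sup_ord A)"
  proof (rule OrdI)
    fix \<beta> assume "\<beta> \<in> elts (sup_ord A)"
    then obtain \<alpha> where a: "\<alpha> \<in> A" "\<beta> \<in> elts \<alpha>" using e by auto
    then show "Ord \<beta>" using A(2) Ord_in_Ord by blast
    show "\<gamma> \<in> elts (sup_ord A)" if "\<gamma> \<in> elts \<beta>" for \<gamma>
      using a A(2)[OF a(1)] Ord_trans[of \<alpha> \<beta> \<gamma>] that e by auto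
  qed
  ultimately show ?thesis by simp
qed

lemmas elts_sup_ord = Ord_Union[THEN conjunct1]

lemma Ord_least: "Ord \<alpha> \<Longrightarrow> P \<alpha> \<Longrightarrow>
   Ord (least_ord P) \<and> P (least_ord P) \<and> (\<forall>\<beta>\<in>elts (least_ord P). \<not> P \<beta>) \<and> elts (least_ord P) \<subseteq> elts \<alpha>"
proof -
  assume a: "Ord \<alpha>" "P \<alpha>"
  have "\<exists>\<mu>. Ord \<mu> \<and> P \<mu> \<and> (\<forall>\<beta>\<in>elts \<mu>. \<not> P \<beta>)"
    using a by (induction \<alpha> rule: elts_induct) (metis Ord_in_Ord)
  then obtain \<mu> where m: "Ord \<mu>" "P \<mu>" "\<forall>\<beta>\<in>elts \<mu>. \<not> P \<beta>" by blast
  have "least_ord P = \<mu>"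
    unfolding least_ord_def using m Ord_linear by (intro the_equality) blast+
  with m a show ?thesis using Ord_not_in_iff by metis
qed

definition osucc :: "'v::zfc \<Rightarrow> 'v" where
  "osucc \<alpha> = set_of (insert \<alpha> (elts \<alpha>))"

lemma elts_osucc [simp]: "elts (osucc \<alpha>) = insert \<alpha> (elts \<alpha>)"
  by (simp add: osucc_def small_insert)

lemma Ord_osucc: "Ord \<alpha> \<Longrightarrow> Ord (osucc \<alpha>)"
  by (rule OrdI) (auto intro: Ord_in_Ord Ord_trans)

lemma limit_ord_osucc: "limit_ord \<alpha> \<Longrightarrow> \<beta> \<in> elts \<alpha> \<Longrightarrow> osucc \<beta> \<in> elts \<alpha>"
proof -
  assume l: "limit_ord \<alpha>" and b: "\<beta> \<in> elts \<alpha>"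
  then obtain \<gamma> where g: "\<gamma> \<in> elts \<alpha>" "\<beta> \<in> elts \<gamma>" by (auto simp: limit_ord_def)
  have o: "Ord \<alpha>" using l by (simp add: limit_ord_def)
  have "Ord \<gamma>" "Ord \<beta>" using o g b Ord_in_Ord by blast+
  then show ?thesis
    using g o by (intro Ord_le_in_trans[of \<alpha> "osucc \<beta>" \<gamma>]) (auto intro: Ord_osucc Ord_trans)
qed

lemma cofinal_in_limit: "limit_ord \<delta> \<Longrightarrow> cofinal_in B \<delta> \<Longrightarrow> \<alpha> \<in> elts \<delta> \<Longrightarrow> \<exists>\<beta>\<in>B. \<alpha> \<in> elts \<beta>"
  using limit_ord_osucc unfolding cofinal_in_def by fastforce

lemma cofinal_in_sup: 
  assumes "limit_ord \<delta>" "cofinal_in B \<delta>" shows "sup_ord B = \<delta>"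
proof -
  have B: "B \<subseteq> elts \<delta>" and o: "Ord \<delta>" using assms by (auto simp: cofinal_in_def limit_ord_def)
  have "small B" using B small_elts small_subset by blast
  then have "elts (sup_ord B) = (\<Union>\<alpha>\<in>B. elts \<alpha>)"
    by (rule elts_sup_ord) (use B o Ord_in_Ord in blast)
  also have "\<dots> = elts \<delta>"
    using cofinal_in_limit[OF assms] B Ord_trans[OF o] by blast
  finally show ?thesis by (rule extensionality)
qed

text \<open>Mostowski collapse of the strict part of \<open>r\<close>. Each value \<open>g a\<close>
  is a set by replacement, for which \<open>A\<close> only has to inject into some set of the
  universe; so \<open>A\<close> may have any HOL type.\<close>

lemma well_ordered_type:
  fixes r :: "'b rel"
  assumes r: "well_order_on A r" and A: "A \<lesssim> elts (x :: 'v::zfc)"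
  shows "\<exists>\<alpha> :: 'v. Ord \<alpha> \<and> elts \<alpha> \<approx> A"
proof -
  have wf: "wf (r - Id)" and lin: "linear_order_on A r"
    using r by (auto simp: well_order_on_def)
  have antis: "antisym r" and tr: "trans r" and tot: "total_on A r" and rA: "r \<subseteq> A \<times> A"
    using lin by (auto simp: linear_order_on_def partial_order_on_def preorder_on_def refl_on_def)
  have sA: "small (f ` B)" if "B \<subseteq> A" for B and f :: "'b \<Rightarrow> 'v"
    by (rule small_lepoll[OF small_elts[of x]])
       (meson A image_lepoll lepoll_trans subset_imp_lepoll that)
  define g :: "'b \<Rightarrow> 'v" where "g = wfrec (r - Id) (\<lambda>f a. set_of (f ` {b. (b, a) \<in> r - Id}))"
  have g: "elts (g a) = g ` {b. (b, a) \<in> r - Id}" for a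
  proof -
    have "g a = set_of (cut g (r - Id) a ` {b. (b, a) \<in> r - Id})"
      unfolding g_def by (subst wfrec[OF wf]) simp
    also have "cut g (r - Id) a ` {b. (b, a) \<in> r - Id} = g ` {b. (b, a) \<in> r - Id}"
      by (rule image_cong) (auto simp: cut_apply)
    finally have "g a = set_of (g ` {b. (b, a) \<in> r - Id})" .
    moreover have "small (g ` {b. (b, a) \<in> r - Id})" by (rule sA) (use rA in blast)
    ultimately show ?thesis using elts_set_of by metis
  qed
  have trg: "v \<in> elts (g a)" if u: "u \<in> elts (g a)" and v: "v \<in> elts u" for a u v
  proof -
    obtain b where b: "u = g b" "(b, a) \<in> r - Id" using u unfolding g by blast
    obtain c where c: "v = g c" "(c, b) \<in> r - Id" using v unfolding b g by blast
    have "(c, a) \<in> r - Id" using b(2) c(2) tr antis by (blast dest: transD antisymD)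
    then show ?thesis unfolding g c(1) by blast
  qed
  have Og: "Ord (g a)" for a
    using wf
  proof (induction a rule: wf_induct_rule)
    case (less a)
    show ?case by (rule OrdI) (use less trg in \<open>auto simp: g\<close>)
  qed
  have inj: "inj_on g A"
  proof (rule inj_onI, rule ccontr)
    fix a b assume ab: "a \<in> A" "b \<in> A" "g a = g b" "a \<noteq> b"
    then have "(a, b) \<in> r - Id \<or> (b, a) \<in> r - Id" using tot by (auto simp: total_on_def)
    then have "g a \<in> elts (g b) \<or> g b \<in> elts (g a)" by (auto simp: g)
    then show False using ab not_in_self by metis
  qed
  define \<alpha> where "\<alpha> = set_of (g ` A)"
  have e: "elts \<alpha> = g ` A" unfolding \<alpha>_def using sA by (intro elts_set_of) auto
  have "Ord \<alpha>"
  proof (rule OrdI)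
    fix \<beta> \<gamma> assume "\<beta> \<in> elts \<alpha>" "\<gamma> \<in> elts \<beta>"
    then show "\<gamma> \<in> elts \<alpha>" using rA unfolding e by (force simp: g)
  qed (auto simp: e Og)
  moreover have "elts \<alpha> \<approx> A" using inj e by (simp add: inj_on_image_eqpoll_self)
  ultimately show ?thesis by blast
qed

lemma ex_Ord_eqpoll: "A \<lesssim> elts (x::'v::zfc) \<Longrightarrow> \<exists>\<alpha>::'v. Ord \<alpha> \<and> elts \<alpha> \<approx> A"
  using well_ordered_type well_order_on by blast

text \<open>Cantor's theorem, with the power set replaced by an ordinal of the same size. It makes
  the minimum in \<open>card_succ\<close> exist.\<close>

lemma ex_Ord_lesspoll: "\<exists>\<alpha>::'v. Ord \<alpha> \<and> elts (x::'v::zfc) \<prec> elts \<alpha>"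
proof -
  obtain p where p: "elts p = {y. elts y \<subseteq> elts x}" using power_set by blast
  have "elts p \<approx> Pow (elts x)"
    unfolding eqpoll_def
    by (rule exI[of _ elts], rule bij_betw_byWitness[of _ set_of])
       (auto simp: p small_subset[OF small_elts[of x]])
  then have "elts x \<prec> elts p" by (meson eqpoll_sym lesspoll_Pow_self lesspoll_eq_trans)
  moreover obtain \<alpha> :: 'v where "Ord \<alpha>" "elts \<alpha> \<approx> elts p" using ex_Ord_eqpoll[of "elts p" p] by auto
  ultimately show ?thesis by (meson eqpoll_sym lesspoll_eq_trans)
qed

subsection \<open>Cardinals\<close>

lemma card_succ_props:
  fixes \<alpha> :: "'v::zfc"
  shows "Ord (card_succ \<alpha>)" "elts \<alpha> \<prec> elts (card_succ \<alpha>)"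
    "\<And>\<beta>. \<beta> \<in> elts (card_succ \<alpha>) \<Longrightarrow> elts \<beta> \<lesssim> elts \<alpha>"
proof -
  obtain \<gamma> :: 'v where "Ord \<gamma>" "elts \<alpha> \<prec> elts \<gamma>" using ex_Ord_lesspoll by blast
  from Ord_least[of \<gamma> "\<lambda>\<beta>. elts \<alpha> \<prec> elts \<beta>", OF this]
  have *: "Ord (card_succ \<alpha>)" "elts \<alpha> \<prec> elts (card_succ \<alpha>)" "\<forall>\<beta>\<in>elts (card_succ \<alpha>). \<not> elts \<alpha> \<prec> elts \<beta>"
    unfolding card_succ_def by blast+
  then show "Ord (card_succ \<alpha>)" "elts \<alpha> \<prec> elts (card_succ \<alpha>)" by auto
  show "elts \<beta> \<lesssim> elts \<alpha>" if "\<beta> \<in> elts (card_succ \<alpha>)" for \<beta>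
  proof (cases "elts \<alpha> \<lesssim> elts \<beta>")
    case True
    then have "elts \<alpha> \<approx> elts \<beta>" using *(3) that by (auto simp: lesspoll_def)
    then show ?thesis by (meson eqpoll_imp_lepoll eqpoll_sym)
  next
    case False
    then show ?thesis
      using ordLeq_total[OF card_of_Well_order card_of_Well_order, of "elts \<alpha>" "elts \<beta>"]
      unfolding lepoll_def card_of_ordLeq by blast
  qed
qed

lemma in_card_succ: "Ord \<alpha> \<Longrightarrow> \<alpha> \<in> elts (card_succ \<alpha>)"
  by (metis Ord_not_in_iff card_succ_props(1,2) lesspoll_not_refl lesspoll_trans2 subset_imp_lepoll)

lemma
  shows Ord_omega: "Ord (omega::'v::zfc)" and infinite_omega: "infinite (elts (omega::'v))"
    and finite_in_omega: "\<And>n. n \<in> elts (omega::'v) \<Longrightarrow> finite (elts n)"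
proof -
  obtain w :: 'v where w: "\<exists>e\<in>elts w. elts e = {}" "\<forall>y\<in>elts w. \<exists>z\<in>elts w. elts z = insert y (elts y)"
    using infinity by blast
  \<comment> \<open>The inductive set \<open>w\<close> need not be an ordinal. It is infinite
    because the iterated successors of the empty set form a strictly \<in>-increasing sequence in
    it; an ordinal of the same size is taken afterwards.\<close>
  have "infinite (elts w)"
  proof -
    obtain e where e: "e \<in> elts w" "elts e = {}" using w(1) by blast
    obtain s where s: "\<And>y. y \<in> elts w \<Longrightarrow> s y \<in> elts w \<and> elts (s y) = insert y (elts y)"
      using w(2) by metis
    define f where "f n = (s ^^ n) e" for n :: nat
    have fw: "f n \<in> elts w" for n by (induction n) (auto simp: f_def e s)
    have sub: "m < n \<Longrightarrow> f m \<in> elts (f n)" for m n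
      by (induction n) (use s fw in \<open>auto simp: f_def less_Suc_eq\<close>)
    have "inj f" by (rule injI) (metis nat_neq_iff not_in_self sub)
    then have "infinite (range f)" by (rule range_inj_infinite)
    then show ?thesis using fw by (meson finite_subset image_subset_iff)
  qed
  moreover obtain \<alpha> :: 'v where "Ord \<alpha>" "elts \<alpha> \<approx> elts w" using ex_Ord_eqpoll[of "elts w" w] by auto
  ultimately have "Ord \<alpha>" "infinite (elts \<alpha>)" using eqpoll_finite_iff by blast+
  from Ord_least[of \<alpha> "\<lambda>\<alpha>. infinite (elts \<alpha>)", OF this]
  show "Ord (omega::'v)" "infinite (elts (omega::'v))" "\<And>n. n \<in> elts (omega::'v) \<Longrightarrow> finite (elts n)"
    unfolding omega_def by blast+
qed

lemma countable_omega: "countable (elts (omega::'v::zfc))"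
proof -
  have "inj_on (\<lambda>n. card (elts n)) (elts (omega::'v))"
  proof (rule inj_onI, rule ccontr)
    fix a b :: 'v assume ab: "a \<in> elts omega" "b \<in> elts omega" "card (elts a) = card (elts b)" "a \<noteq> b"
    have "Ord a" "Ord b" using ab Ord_omega Ord_in_Ord by blast+
    with ab(4) have "elts a \<subset> elts b \<or> elts b \<subset> elts a" using Ord_linear Ord_subset not_in_self
      by (metis psubsetI)
    then show False using ab finite_in_omega psubset_card_mono by (metis nat_less_le)
  qed
  then show ?thesis by (meson countableI')
qed

lemma small_countable: "countable A \<Longrightarrow> small (A::'v::zfc set)"
proof -
  assume "countable A"
  then have "A \<lesssim> (UNIV::nat set)" by (auto simp: lepoll_def countable_def)
  also have "(UNIV::nat set) \<lesssim> elts (omega::'v)" using infinite_omega infinite_le_lepoll by blast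
  finally show ?thesis using small_lepoll small_elts by blast
qed

lemma countable_lepoll_infinite: "countable A \<Longrightarrow> infinite B \<Longrightarrow> A \<lesssim> B"
  by (metis countable_def infinite_le_lepoll lepoll_def lepoll_trans subset_UNIV)

lemma Ord_omega1: "Ord omega1"
  unfolding omega1_def by (rule card_succ_props)

lemma uncountable_omega1: "uncountable (elts omega1)"
  unfolding omega1_def
  using card_succ_props(2)[of omega] countable_lepoll_infinite infinite_omega lepoll_antisym
  by (auto simp: lesspoll_def)

lemma countable_in_omega1: "\<alpha> \<in> elts omega1 \<Longrightarrow> countable (elts \<alpha>)"
  unfolding omega1_def using card_succ_props(3) countable_lepoll countable_omega by blast

lemma in_omega1I: "Ord \<alpha> \<Longrightarrow> countable (elts \<alpha>) \<Longrightarrow> \<alpha> \<in> elts omega1"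
  using Ord_not_in_iff[OF _ Ord_omega1, of \<alpha>] countable_subset uncountable_omega1 by blast

lemma omega_in_omega1: "omega \<in> elts omega1"
  by (simp add: in_omega1I Ord_omega countable_omega)

section \<open>Cardinal arithmetic of infinite sets\<close>

lemma infinite_times_lepoll: "infinite M \<Longrightarrow> M \<times> M \<lesssim> M"
  using card_of_Times_same_infinite eqpoll_iff_card_of_ordIso eqpoll_imp_lepoll by blast

lemma UN_lepoll_infinite:
  assumes M: "infinite M" and I: "I \<lesssim> M" and B: "\<And>i. i \<in> I \<Longrightarrow> B i \<lesssim> M"
  shows "(\<Union>i\<in>I. B i) \<lesssim> M"
proof -
  obtain g where g: "\<And>i. i \<in> I \<Longrightarrow> B i \<subseteq> g i ` M" using B unfolding lepoll_iff by metis
  have "(\<Union>i\<in>I. B i) \<subseteq> (\<lambda>(i, m). g i m) ` (I \<times> M)"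
    using g by (fastforce simp: image_iff)
  then have "(\<Union>i\<in>I. B i) \<lesssim> I \<times> M" by (rule subset_image_lepoll)
  also have "\<dots> \<lesssim> M \<times> M" using I by (intro times_lepoll_mono) auto
  also have "\<dots> \<lesssim> M" by (rule infinite_times_lepoll[OF M])
  finally show ?thesis .
qed

lemma Un_lepoll_infinite: "infinite M \<Longrightarrow> A \<lesssim> M \<Longrightarrow> B \<lesssim> M \<Longrightarrow> A \<union> B \<lesssim> M"
  using UN_lepoll_infinite[of M "{A, B}" id] by (auto simp: finite_lepoll_infinite)

lemma lists_lepoll_infinite:
  assumes M: "infinite M" and B: "B \<lesssim> M" shows "lists B \<lesssim> M"
proof -
  have *: "{l \<in> lists B. length l = n} \<lesssim> M" for n
  proof (induction n)
    case 0
    have "{l \<in> lists B. length l = 0} = {[]}" by auto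
    then show ?case using M by (simp add: finite_lepoll_infinite)
  next
    case (Suc n)
    have "{l \<in> lists B. length l = Suc n} = (\<Union>x\<in>B. (#) x ` {l \<in> lists B. length l = n})"
      by (force simp: length_Suc_conv)
    also have "\<dots> \<lesssim> M"
      by (rule UN_lepoll_infinite[OF M B]) (rule lepoll_trans[OF image_lepoll Suc])
    finally show ?case .
  qed
  have "lists B = (\<Union>n\<in>(UNIV::nat set). {l \<in> lists B. length l = n})" by auto
  also have "\<dots> \<lesssim> M"
    by (rule UN_lepoll_infinite[OF M]) (use M * in \<open>auto simp: infinite_le_lepoll\<close>)
  finally show ?thesis .
qed

section \<open>Regular cardinals and cofinality\<close>

lemma regular_Ord: "regular_cardinal \<kappa> \<Longrightarrow> Ord \<kappa>"
  by (simp add: regular_cardinal_def cardinal_def)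

lemma cf_least:
  assumes "Ord \<delta>"
  shows "Ord (cf \<delta>)" "\<exists>f. cofinal_in (f ` elts (cf \<delta>)) \<delta>" "\<And>\<beta> f. \<beta> \<in> elts (cf \<delta>) \<Longrightarrow> \<not> cofinal_in (f ` elts \<beta>) \<delta>"
proof -
  have "\<exists>f. cofinal_in (f ` elts \<delta>) \<delta>" by (rule exI[of _ id]) (auto simp: cofinal_in_def)
  from Ord_least[of \<delta> "\<lambda>\<beta>. \<exists>f. cofinal_in (f ` elts \<beta>) \<delta>", OF assms this]
  show "Ord (cf \<delta>)" "\<exists>f. cofinal_in (f ` elts (cf \<delta>)) \<delta>" "\<And>\<beta> f. \<beta> \<in> elts (cf \<delta>) \<Longrightarrow> \<not> cofinal_in (f ` elts \<beta>) \<delta>"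
    by (auto simp: cf_def)
qed

lemma regular_bounded:
  assumes "regular_cardinal \<kappa>" "B \<subseteq> elts \<kappa>" "B \<lesssim> elts \<mu>" "\<mu> \<in> elts \<kappa>"
  shows "\<exists>\<beta>\<in>elts \<kappa>. B \<subseteq> elts \<beta>"
proof (cases "B = {}")
  case True
  then show ?thesis using assms by auto
next
  case False
  have o: "Ord \<kappa>" using assms regular_Ord by blast
  obtain f where f: "B \<subseteq> f ` elts \<mu>" using assms(3) by (auto simp: lepoll_iff)
  obtain b where b: "b \<in> B" using False by blast
  define g where "g x = (if f x \<in> B then f x else b)" for x
  have gB: "g ` elts \<mu> = B" using f b by (auto simp: g_def image_iff)
  have "\<not> cofinal_in B \<kappa>"
    using cf_least(3)[OF o, of \<mu> g] assms gB by (simp add: regular_cardinal_def)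
  then obtain \<alpha> where "\<alpha> \<in> elts \<kappa>" "\<And>\<beta>. \<beta> \<in> B \<Longrightarrow> \<not> elts \<alpha> \<subseteq> elts \<beta>"
    using assms(2) by (auto simp: cofinal_in_def)
  then show ?thesis using assms(2) o Ord_in_Ord Ord_not_in_iff by (metis subset_iff)
qed

lemma regular_limit: "regular_cardinal \<kappa> \<Longrightarrow> limit_ord \<kappa>"
proof -
  assume r: "regular_cardinal \<kappa>"
  have o: "Ord \<kappa>" and inf: "infinite (elts \<kappa>)" using r regular_Ord by (auto simp: regular_cardinal_def)
  have "\<exists>\<gamma>\<in>elts \<kappa>. \<beta> \<in> elts \<gamma>" if b: "\<beta> \<in> elts \<kappa>" for \<beta>
  proof (rule ccontr)
    assume c: "\<not> ?thesis"
    have "elts \<kappa> \<subseteq> insert \<beta> (elts \<beta>)" using c Ord_linear Ord_in_Ord[OF o] b by blast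
    then have k: "elts \<kappa> = insert \<beta> (elts \<beta>)" using b Ord_subset[OF o] by blast
    then have "infinite (elts \<beta>)" using inf by auto
    then have "elts \<beta> \<approx> elts \<kappa>" unfolding k by (metis eqpoll_sym infinite_insert_eqpoll)
    then show False using r b by (auto simp: regular_cardinal_def cardinal_def)
  qed
  then show ?thesis using o inf by (auto simp: limit_ord_def)
qed

text \<open>A shorter cofinal map would cover the successor of \<mu> by at most \<mu> sets of size
  at most \<mu>. Passing to \<open>osucc\<close> compensates for the weak inequality in
  \<open>cofinal_in\<close>.\<close>

lemma regular_card_succ:
  assumes inf: "infinite (elts \<mu>)"
  shows "regular_cardinal (card_succ \<mu>)"
proof -
  let ?k = "card_succ \<mu>"
  note p = card_succ_props[where \<alpha> = \<mu>]
  have "\<not> elts \<alpha> \<approx> elts ?k" if "\<alpha> \<in> elts ?k" for \<alpha>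
  proof
    assume "elts \<alpha> \<approx> elts ?k"
    then have "elts ?k \<lesssim> elts \<mu>" using p(3)[OF that] eqpoll_sym lepoll_trans1 by blast
    then show False using p(2) lesspoll_trans2 lesspoll_not_refl by blast
  qed
  then have card: "cardinal ?k" unfolding cardinal_def using p(1) by blast
  have infk: "infinite (elts ?k)" using p(2) inf
    by (meson finite_lepoll_infinite lepoll_antisym lesspoll_def eqpoll_finite_iff)
  have nc: "\<not> cofinal_in (f ` elts \<beta>) ?k" if "\<beta> \<in> elts ?k" for \<beta> f
  proof
    assume c: "cofinal_in (f ` elts \<beta>) ?k"
    have "elts ?k \<subseteq> (\<Union>\<xi>\<in>elts \<beta>. elts (osucc (f \<xi>)))"
    proof
      fix \<alpha> assume a: "\<alpha> \<in> elts ?k"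
      then obtain \<xi> where x: "\<xi> \<in> elts \<beta>" "elts \<alpha> \<subseteq> elts (f \<xi>)" "f \<xi> \<in> elts ?k"
        using c unfolding cofinal_in_def by blast
      then have "\<alpha> \<in> elts (f \<xi>) \<or> \<alpha> = f \<xi>" using Ord_subset_iff a Ord_in_Ord[OF p(1)] by blast
      then show "\<alpha> \<in> (\<Union>\<xi>\<in>elts \<beta>. elts (osucc (f \<xi>)))" using x by auto
    qed
    then have "elts ?k \<lesssim> (\<Union>\<xi>\<in>elts \<beta>. elts (osucc (f \<xi>)))"
      by (rule subset_imp_lepoll)
    also have "\<dots> \<lesssim> elts \<mu>"
    proof (rule UN_lepoll_infinite[OF inf])
      show "elts \<beta> \<lesssim> elts \<mu>" using p(3) that .
      fix \<xi> assume "\<xi> \<in> elts \<beta>"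
      then have "f \<xi> \<in> elts ?k" using c by (auto simp: cofinal_in_def)
      then have "elts (f \<xi>) \<lesssim> elts \<mu>" by (rule p(3))
      then show "elts (osucc (f \<xi>)) \<lesssim> elts \<mu>"
        using Un_lepoll_infinite[OF inf, of "{f \<xi>}" "elts (f \<xi>)"] inf by (simp add: finite_lepoll_infinite)
    qed
    finally have "elts ?k \<lesssim> elts \<mu>" .
    then show False using p(2) by (meson lesspoll_not_refl lesspoll_trans2)
  qed
  have "cf ?k = ?k"
  proof -
    note q = cf_least[OF p(1)]
    have "cf ?k \<notin> elts ?k" using q(2) nc by blast
    moreover have "?k \<notin> elts (cf ?k)" using q(3)[of ?k id] by (auto simp: cofinal_in_def)
    ultimately show ?thesis using Ord_linear[OF p(1) q(1)] by auto
  qed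
  then show ?thesis using card infk by (simp add: regular_cardinal_def)
qed

lemma regular_omega1: "regular_cardinal omega1"
  unfolding omega1_def by (rule regular_card_succ[OF infinite_omega])

lemma uncountable_regular: "regular_cardinal \<kappa> \<Longrightarrow> omega1 \<in> elts \<kappa> \<Longrightarrow> uncountable (elts \<kappa>)"
  using countable_subset[OF Ord_subset[OF regular_Ord]] uncountable_omega1 by blast

lemma omega_in_uncountable: "Ord \<kappa> \<Longrightarrow> uncountable (elts \<kappa>) \<Longrightarrow> omega \<in> elts \<kappa>"
  using Ord_not_in_iff[OF Ord_omega] countable_subset[OF _ countable_omega] by blast

lemma countable_bounded:
  assumes "regular_cardinal \<kappa>" "uncountable (elts \<kappa>)" "B \<subseteq> elts \<kappa>" "countable B"
  shows "\<exists>\<beta>\<in>elts \<kappa>. B \<subseteq> elts \<beta>"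
  by (rule regular_bounded[OF assms(1,3) countable_lepoll_infinite[OF assms(4) infinite_omega]
      omega_in_uncountable[OF regular_Ord[OF assms(1)] assms(2)]])

lemma cf_omega_limit:
  assumes o: "Ord \<delta>" and c: "cf \<delta> = omega"
  shows "limit_ord \<delta>" "\<exists>E. countable E \<and> cofinal_in E \<delta>"
proof -
  note q = cf_least[OF o, unfolded c]
  have "elts (omega::'a) \<noteq> {}" using infinite_omega by (metis finite.emptyI)
  then have "elts \<delta> \<noteq> {}"
    using q(2) by (auto simp: cofinal_in_def)
  moreover have "\<exists>\<gamma>\<in>elts \<delta>. \<beta> \<in> elts \<gamma>" if b: "\<beta> \<in> elts \<delta>" for \<beta>
  proof (rule ccontr)
    assume n: "\<not> ?thesis"
    have all: "elts \<alpha> \<subseteq> elts \<beta>" if "\<alpha> \<in> elts \<delta>" for \<alpha>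
      using n that b Ord_in_Ord[OF o] Ord_not_in_iff by blast
    have inf: "infinite (elts (omega::'a))" by (rule infinite_omega)
    then obtain n :: 'a where n: "n \<in> elts omega" by fastforce
    have "finite (insert n (elts n))" using finite_in_omega n by auto
    with inf obtain m where m: "m \<in> elts (omega::'a)" "m \<notin> insert n (elts n)" 
      by (metis finite_subset subsetI)
    \<comment> \<open>\<open>m\<close> is taken above some \<open>n\<close> in order to be nonempty:
      then the constant map on it has image {\<beta>}, which is cofinal when \<beta> is the maximum
      of \<delta>.\<close>
    have "n \<in> elts m" using m n Ord_linear Ord_in_Ord[OF Ord_omega] by blast
    then have "(\<lambda>_. \<beta>) ` elts m = {\<beta>}" by auto
    then have "cofinal_in ((\<lambda>_. \<beta>) ` elts m) \<delta>" using all b by (auto simp: cofinal_in_def)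
    then show False using q(3) m by blast
  qed
  ultimately show "limit_ord \<delta>" using o by (simp add: limit_ord_def)
  show "\<exists>E. countable E \<and> cofinal_in E \<delta>" using q(2) countable_omega by blast
qed

section \<open>Closure points and hulls\<close>

lemma limit_ord_two:
  assumes "limit_ord \<kappa>" "\<alpha> \<in> elts \<kappa>" "\<beta> \<in> elts \<kappa>"
  shows "\<exists>\<gamma>\<in>elts \<kappa>. \<alpha> \<in> elts \<gamma> \<and> \<beta> \<in> elts \<gamma>"
proof -
  have o: "Ord \<kappa>" using assms by (simp add: limit_ord_def)
  consider "elts \<alpha> \<subseteq> elts \<beta>" | "\<beta> \<in> elts \<alpha>" 
    using Ord_not_in_iff Ord_in_Ord[OF o] assms by blast
  then show ?thesis
  proof cases
    case 1
    then have "\<alpha> \<in> elts (osucc \<beta>)" using Ord_subset_iff Ord_in_Ord[OF o] assms by auto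
    then show ?thesis using limit_ord_osucc[OF assms(1,3)] by (intro bexI[of _ "osucc \<beta>"]) auto
  next
    case 2
    then show ?thesis using limit_ord_osucc[OF assms(1,2)] by (intro bexI[of _ "osucc \<alpha>"]) auto
  qed
qed

text \<open>Iterating \<open>f\<close> \<omega> times above \<alpha> gives the cofinal half; the
  supremum stays below \<kappa> because \<kappa> is uncountable. \<open>regular_cardinal\<close>
  includes \<omega>, hence the separate hypothesis of uncountability here and later.\<close>

lemma closure_points_club:
  assumes r: "regular_cardinal \<kappa>" and u: "uncountable (elts \<kappa>)"
    and h: "\<And>\<alpha>. \<alpha> \<in> elts \<kappa> \<Longrightarrow> h \<alpha> \<in> elts \<kappa>"
  shows "club_in {\<delta> \<in> elts \<kappa>. limit_ord \<delta> \<and> (\<forall>\<alpha>\<in>elts \<delta>. h \<alpha> \<in> elts \<delta>)} \<kappa>" (is "club_in ?C \<kappa>")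
proof -
  have o: "Ord \<kappa>" and l: "limit_ord \<kappa>" using r regular_Ord regular_limit by auto
  have ok: "Ord \<alpha>" if "\<alpha> \<in> elts \<kappa>" for \<alpha> using that o Ord_in_Ord by blast
  have step: "\<exists>\<gamma>\<in>elts \<kappa>. \<alpha> \<in> elts \<gamma> \<and> h ` elts \<alpha> \<subseteq> elts \<gamma>" if a: "\<alpha> \<in> elts \<kappa>" for \<alpha>
  proof -
    have "h ` elts \<alpha> \<subseteq> elts \<kappa>" using h a Ord_trans[OF o] by blast
    from regular_bounded[OF r this image_lepoll a]
    obtain \<beta> where b: "\<beta> \<in> elts \<kappa>" "h ` elts \<alpha> \<subseteq> elts \<beta>" by blast
    obtain \<gamma> where g: "\<gamma> \<in> elts \<kappa>" "\<alpha> \<in> elts \<gamma>" "\<beta> \<in> elts \<gamma>" using limit_ord_two[OF l a b(1)] by blast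
    have "elts \<beta> \<subseteq> elts \<gamma>" using Ord_subset[OF ok[OF g(1)] g(3)] .
    then show ?thesis using g b by blast
  qed
  then obtain f where f: "\<And>\<alpha>. \<alpha> \<in> elts \<kappa> \<Longrightarrow> f \<alpha> \<in> elts \<kappa> \<and> \<alpha> \<in> elts (f \<alpha>) \<and> h ` elts \<alpha> \<subseteq> elts (f \<alpha>)"
    by metis
  have cof: "\<exists>\<delta>\<in>?C. elts \<alpha> \<subseteq> elts \<delta>" if a: "\<alpha> \<in> elts \<kappa>" for \<alpha>
  proof -
    define s where "s n = (f ^^ n) \<alpha>" for n :: nat
    have sk: "s n \<in> elts \<kappa>" for n by (induction n) (use a f in \<open>auto simp: s_def\<close>)
    have ss: "s n \<in> elts (s (Suc n))" "h ` elts (s n) \<subseteq> elts (s (Suc n))" for n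
      using f[OF sk[of n]] by (auto simp: s_def)
    have "countable (range s)" by auto
    define \<delta> where "\<delta> = sup_ord (range s)"
    have e: "elts \<delta> = (\<Union>n. elts (s n))" and od: "Ord \<delta>"
      using Ord_Union[OF small_countable[OF \<open>countable (range s)\<close>]] ok sk unfolding \<delta>_def by auto
    obtain \<beta> where b: "\<beta> \<in> elts \<kappa>" "range s \<subseteq> elts \<beta>"
      using countable_bounded[OF r u _ \<open>countable (range s)\<close>] sk by blast
    have "elts (s n) \<subseteq> elts \<beta>" for n using Ord_subset[OF ok[OF b(1)]] b(2) by blast
    then have "elts \<delta> \<subseteq> elts \<beta>" using e by blast
    then have dk: "\<delta> \<in> elts \<kappa>" using Ord_le_in_trans[OF o od _ b(1)] by blast
    have sd: "s n \<in> elts \<delta>" for n using e ss(1) by blast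
    have "limit_ord \<delta>" unfolding limit_ord_def using od sd e by blast
    moreover have "h \<xi> \<in> elts \<delta>" if "\<xi> \<in> elts \<delta>" for \<xi>
      using that ss(2) unfolding e by blast
    moreover have "elts \<alpha> \<subseteq> elts \<delta>" using e by (force simp: s_def intro: exI[of _ 0])
    ultimately show ?thesis using dk by blast
  qed
  have closed: "\<alpha> \<in> ?C" if "\<alpha> \<in> elts \<kappa>" "limit_ord \<alpha>" "cofinal_in (?C \<inter> elts \<alpha>) \<alpha>" for \<alpha>
  proof -
    have "h \<xi> \<in> elts \<alpha>" if x: "\<xi> \<in> elts \<alpha>" for \<xi>
    proof -
      obtain \<beta> where "\<beta> \<in> ?C \<inter> elts \<alpha>" "\<xi> \<in> elts \<beta>" 
        using cofinal_in_limit[OF \<open>limit_ord \<alpha>\<close> \<open>cofinal_in (?C \<inter> elts \<alpha>) \<alpha>\<close> x] by blast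
      then show ?thesis using Ord_trans[OF ok[OF \<open>\<alpha> \<in> elts \<kappa>\<close>], of \<beta> "h \<xi>"] by blast
    qed
    then show ?thesis using that by blast
  qed
  have "?C \<subseteq> elts \<kappa>" by blast
  then show ?thesis
    unfolding club_in_def cofinal_in_def[of ?C \<kappa>] using cof closed by simp
qed

lemma stationary_closure_point:
  assumes "regular_cardinal \<kappa>" "uncountable (elts \<kappa>)" "stationary_in S \<kappa>"
    and "\<And>\<alpha>. \<alpha> \<in> elts \<kappa> \<Longrightarrow> h \<alpha> \<in> elts \<kappa>"
  shows "\<exists>\<delta>\<in>S. limit_ord \<delta> \<and> (\<forall>\<alpha>\<in>elts \<delta>. h \<alpha> \<in> elts \<delta>)"
proof -
  have "S \<inter> {\<delta> \<in> elts \<kappa>. limit_ord \<delta> \<and> (\<forall>\<alpha>\<in>elts \<delta>. h \<alpha> \<in> elts \<delta>)} \<noteq> {}"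
    using assms(3) closure_points_club[of \<kappa> h, OF assms(1,2,4)] unfolding stationary_in_def by blast
  then show ?thesis by blast
qed

section \<open>Closure under operators with countable values\<close>

lemma lists_directed_UN:
  assumes "l \<in> lists (\<Union>i\<in>I. D i)" "I \<noteq> {}"
    and dir: "\<And>i j. i \<in> I \<Longrightarrow> j \<in> I \<Longrightarrow> \<exists>k\<in>I. D i \<union> D j \<subseteq> D k"
  shows "\<exists>i\<in>I. l \<in> lists (D i)"
  using assms(1)
proof (induction l)
  case Nil
  then show ?case using assms(2) by auto
next
  case (Cons x l)
  then obtain i j where ij: "i \<in> I" "x \<in> D i" "j \<in> I" "l \<in> lists (D j)" by auto
  then obtain k where "k \<in> I" "D i \<union> D j \<subseteq> D k" using dir by blast
  then show ?case using ij by (auto intro!: bexI[of _ k])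
qed

lemma lists_incseq_UN:
  fixes D :: "nat \<Rightarrow> 'a set"
  assumes "\<And>n. D n \<subseteq> D (Suc n)" "l \<in> lists (\<Union>n. D n)"
  shows "\<exists>n. l \<in> lists (D n)"
proof -
  have "mono D" using assms(1) by (simp add: mono_iff_le_Suc)
  then have "\<exists>k\<in>UNIV. D i \<union> D j \<subseteq> D k" for i j
    using monoD[of D i "max i j"] monoD[of D j "max i j"] by (intro bexI[of _ "max i j"]) auto
  from lists_directed_UN[OF assms(2) _ this] show ?thesis by auto
qed

text \<open>With countable values, one set-valued operator on finite lists encodes countably many
  finitary functions at once.\<close>

inductive_set hull :: "('a list \<Rightarrow> 'a set) \<Rightarrow> 'a set \<Rightarrow> 'a set" for G B where
  base: "x \<in> B \<Longrightarrow> x \<in> hull G B"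
| step: "l \<in> lists (hull G B) \<Longrightarrow> x \<in> G l \<Longrightarrow> x \<in> hull G B"
  monos lists_mono

lemma hull_minimal: "B \<subseteq> N \<Longrightarrow> (\<And>l. l \<in> lists N \<Longrightarrow> G l \<subseteq> N) \<Longrightarrow> hull G B \<subseteq> N"
proof
  fix x assume N: "B \<subseteq> N" "\<And>l. l \<in> lists N \<Longrightarrow> G l \<subseteq> N" and "x \<in> hull G B"
  from this(3) show "x \<in> N"
    by induction (use N in \<open>auto simp: lists_eq_set subset_iff\<close>)
qed

lemma hull_mono: "B \<subseteq> B' \<Longrightarrow> hull G B \<subseteq> hull G B'"
  by (rule hull_minimal) (auto intro: hull.intros)

lemma hull_lepoll:
  assumes M: "infinite M" and B: "B \<lesssim> M" and G: "\<And>l. countable (G l)"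
  shows "hull G B \<lesssim> M"
proof -
  define c where "c = rec_nat B (\<lambda>_ X. X \<union> (\<Union>l\<in>lists X. G l))"
  have c: "c 0 = B" "c (Suc n) = c n \<union> (\<Union>l\<in>lists (c n). G l)" for n by (simp_all add: c_def)
  have "c n \<lesssim> M" for n
  proof (induction n)
    case (Suc n)
    have "(\<Union>l\<in>lists (c n). G l) \<lesssim> M"
      by (rule UN_lepoll_infinite[OF M lists_lepoll_infinite[OF M Suc]])
         (rule countable_lepoll_infinite[OF G M])
    then show ?case unfolding c by (rule Un_lepoll_infinite[OF M Suc])
  qed (simp add: c B)
  then have "(\<Union>n. c n) \<lesssim> M"
    using M by (intro UN_lepoll_infinite[OF M]) (auto simp: infinite_le_lepoll)
  moreover have "hull G B \<subseteq> (\<Union>n. c n)"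
  proof (rule hull_minimal)
    show "B \<subseteq> (\<Union>n. c n)" using c(1) by blast
    show "G l \<subseteq> (\<Union>n. c n)" if l: "l \<in> lists (\<Union>n. c n)" for l
    proof -
      obtain n where "l \<in> lists (c n)" using lists_incseq_UN[OF _ l] c(2) by blast
      then have "G l \<subseteq> c (Suc n)" unfolding c by blast
      then show ?thesis by blast
    qed
  qed
  ultimately show ?thesis using lepoll_trans subset_imp_lepoll by blast
qed

text \<open>The hull of B together with some \<alpha> < \<kappa> has size below \<kappa>, so
  \<open>h\<close> bounds its trace on \<kappa>. At a closure point \<delta> of \<open>h\<close> in
  S the union of these hulls meets \<kappa> in exactly \<delta>. The set N plays the part of an
  elementary substructure.\<close>

lemma stationary_closed_set:
  assumes r: "regular_cardinal \<kappa>" and u: "uncountable (elts \<kappa>)" and S: "stationary_in S \<kappa>"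
    and B: "countable B" and G: "\<And>l. countable (G l)"
  shows "\<exists>\<delta>\<in>S. limit_ord \<delta> \<and> (\<exists>N. B \<subseteq> N \<and> (\<forall>l\<in>lists N. G l \<subseteq> N) \<and> N \<inter> elts \<kappa> = elts \<delta>)"
proof -
  have o: "Ord \<kappa>" and l: "limit_ord \<kappa>" using r regular_Ord regular_limit by auto
  define Hu where "Hu \<alpha> = hull G (B \<union> elts \<alpha>)" for \<alpha>
  have "\<exists>\<beta>\<in>elts \<kappa>. Hu \<alpha> \<inter> elts \<kappa> \<subseteq> elts \<beta>" if a: "\<alpha> \<in> elts \<kappa>" for \<alpha>
  proof -
    obtain \<mu> where m: "\<mu> \<in> elts \<kappa>" "\<alpha> \<in> elts \<mu>" "omega \<in> elts \<mu>"
      using limit_ord_two[OF l a omega_in_uncountable[OF o u]] by blast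
    have sub: "elts \<alpha> \<subseteq> elts \<mu>" "elts omega \<subseteq> elts \<mu>" using m Ord_subset Ord_in_Ord[OF o] by blast+
    then have inf: "infinite (elts \<mu>)" using infinite_omega infinite_super by blast
    have "Hu \<alpha> \<lesssim> elts \<mu>" unfolding Hu_def
      by (intro hull_lepoll inf Un_lepoll_infinite countable_lepoll_infinite B G subset_imp_lepoll sub)
    then have "Hu \<alpha> \<inter> elts \<kappa> \<lesssim> elts \<mu>" by (meson Int_lower1 lepoll_trans subset_imp_lepoll)
    from regular_bounded[OF r _ this m(1)] show ?thesis by blast
  qed
  then obtain h where h: "\<And>\<alpha>. \<alpha> \<in> elts \<kappa> \<Longrightarrow> h \<alpha> \<in> elts \<kappa> \<and> Hu \<alpha> \<inter> elts \<kappa> \<subseteq> elts (h \<alpha>)" by metis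
  obtain \<delta> where d: "\<delta> \<in> S" "limit_ord \<delta>" "\<forall>\<alpha>\<in>elts \<delta>. h \<alpha> \<in> elts \<delta>"
    using stationary_closure_point[OF r u S, of h] h by blast
  have dk: "\<delta> \<in> elts \<kappa>" using d(1) S by (auto simp: stationary_in_def)
  have od: "Ord \<delta>" and ne: "elts \<delta> \<noteq> {}" using d(2) by (auto simp: limit_ord_def)
  define N where "N = (\<Union>\<alpha>\<in>elts \<delta>. Hu \<alpha>)"
  have "B \<subseteq> N" unfolding N_def Hu_def using ne by (auto intro: hull.base)
  moreover have "G t \<subseteq> N" if t: "t \<in> lists N" for t
  proof -
    have "\<exists>\<gamma>\<in>elts \<delta>. Hu \<alpha> \<union> Hu \<beta> \<subseteq> Hu \<gamma>" if ab: "\<alpha> \<in> elts \<delta>" "\<beta> \<in> elts \<delta>" for \<alpha> \<beta>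
    proof -
      obtain \<gamma> where g: "\<gamma> \<in> elts \<delta>" "\<alpha> \<in> elts \<gamma>" "\<beta> \<in> elts \<gamma>" using limit_ord_two[OF d(2) ab] by blast
      have "elts \<alpha> \<subseteq> elts \<gamma>" "elts \<beta> \<subseteq> elts \<gamma>" using g Ord_subset Ord_in_Ord[OF od] by blast+
      then have "Hu \<alpha> \<subseteq> Hu \<gamma>" "Hu \<beta> \<subseteq> Hu \<gamma>" unfolding Hu_def by (intro hull_mono; blast)+
      then show ?thesis using g by blast
    qed
    from lists_directed_UN[OF t[unfolded N_def] ne this]
    obtain \<alpha> where "\<alpha> \<in> elts \<delta>" "t \<in> lists (Hu \<alpha>)" by blast
    then show ?thesis unfolding N_def Hu_def by (auto intro: hull.step)
  qed
  moreover have "N \<inter> elts \<kappa> = elts \<delta>"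
  proof
    show "N \<inter> elts \<kappa> \<subseteq> elts \<delta>"
    proof
      fix x assume x: "x \<in> N \<inter> elts \<kappa>"
      then obtain \<alpha> where a: "\<alpha> \<in> elts \<delta>" "x \<in> Hu \<alpha>" unfolding N_def by blast
      then have "x \<in> elts (h \<alpha>)" using h Ord_trans[OF o dk] x by blast
      then show "x \<in> elts \<delta>" using Ord_trans[OF od] d(3) a by blast
    qed
    show "elts \<delta> \<subseteq> N \<inter> elts \<kappa>"
    proof
      fix x assume x: "x \<in> elts \<delta>"
      then obtain \<alpha> where "\<alpha> \<in> elts \<delta>" "x \<in> elts \<alpha>" using d(2) by (auto simp: limit_ord_def)
      then have "x \<in> N" unfolding N_def Hu_def by (auto intro: hull.base)
      then show "x \<in> N \<inter> elts \<kappa>" using x dk Ord_trans[OF o] by blast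
    qed
  qed
  ultimately show ?thesis using d by blast
qed

text \<open>The sequence increases and dominates an enumeration of E, so it is eventually above each
  \<alpha>. Mere cofinality would not do: in the tree only its values at the levels labelled by one
  cardinal are used, and of these levels it is only known that there are infinitely many.\<close>

lemma countable_cofinal_seq:
  assumes l: "limit_ord \<delta>" and E: "countable E" "cofinal_in E \<delta>"
  shows "\<exists>c :: nat \<Rightarrow> 'v::zfc. (\<forall>n. c n \<in> elts \<delta>) \<and> (\<forall>\<alpha>\<in>elts \<delta>. \<exists>n. \<forall>m\<ge>n. \<alpha> \<in> elts (c m))"
proof -
  have od: "Ord \<delta>" and ne: "elts \<delta> \<noteq> {}" using l by (auto simp: limit_ord_def)
  have En: "E \<noteq> {}" "E \<subseteq> elts \<delta>" using E ne unfolding cofinal_in_def by blast+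
  let ?e = "from_nat_into E"
  have e: "?e n \<in> elts \<delta>" for n using En(2) from_nat_into[OF En(1), of n] by blast
  obtain a where a: "a \<in> elts \<delta>" using ne by blast
  have "\<exists>c. \<forall>n. c n \<in> elts \<delta> \<and> (c n \<in> elts (c (Suc n)) \<and> ?e n \<in> elts (c (Suc n)))"
  proof (rule dependent_nat_choice)
    show "\<exists>x. x \<in> elts \<delta>" using a by blast
    show "\<exists>y. y \<in> elts \<delta> \<and> (x \<in> elts y \<and> ?e n \<in> elts y)" if "x \<in> elts \<delta>" for x n
      using limit_ord_two[OF l that e[of n]] by blast
  qed
  then obtain c where c: "\<And>n. c n \<in> elts \<delta>" "\<And>n. c n \<in> elts (c (Suc n))" "\<And>n. ?e n \<in> elts (c (Suc n))" by blast
  have oc: "Ord (c n)" for n using c(1) od Ord_in_Ord by blast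
  have "\<exists>n. \<forall>m\<ge>n. \<alpha> \<in> elts (c m)" if a: "\<alpha> \<in> elts \<delta>" for \<alpha>
  proof -
    obtain \<beta> where b: "\<beta> \<in> E" "\<alpha> \<in> elts \<beta>" using cofinal_in_limit[OF l E(2) a] by blast
    then obtain n where n: "\<beta> = ?e n" using from_nat_into_surj[OF E(1) b(1)] by metis
    have "\<alpha> \<in> elts (c m)" if "m \<ge> Suc n" for m
      using that
    proof (induction m rule: dec_induct)
      case base
      then show ?case using Ord_trans[OF oc c(3)] b n by blast
    next
      case (step m)
      then show ?case using Ord_trans[OF oc c(2)] by blast
    qed
    then show ?thesis by blast
  qed
  then show ?thesis using c(1) by blast
qed

section \<open>Mutual stationarity of sets of ordinals of countable cofinality\<close>

text \<open>
  Nodes are finite sequences. A subtree \<open>T\<close> is perfect outside \<open>D\<close> if a node \<open>t\<close> whose label \<open>lab t\<close>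
  is not in \<open>D\<close> has unboundedly many successors below \<open>lab t\<close>. One cardinal \<open>\<kappa>\<close> is moved into \<open>D\<close>
  at a time, at the cost of thinning out the tree so that \<open>F t \<inter> \<kappa>\<close> stays below a fixed \<open>\<delta>\<close>.
\<close>

locale labelled_tree =
  fixes F :: "'v::zfc list \<Rightarrow> 'v set" and lab :: "'v list \<Rightarrow> 'v"
  assumes countable_F: "countable (F t)"
    and lab_in_F: "lab t \<in> F t"
    and regular_lab: "regular_cardinal (lab t)"
    and uncountable_lab: "uncountable (elts (lab t))"
begin

definition perfect_off :: "'v set \<Rightarrow> 'v list set \<Rightarrow> bool" where
  "perfect_off D T \<longleftrightarrow> (\<forall>t\<in>T.
     (lab t \<in> D \<longrightarrow> (\<exists>x. t @ [x] \<in> T)) \<and>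
     (lab t \<notin> D \<longrightarrow> (\<forall>\<beta>\<in>elts (lab t). \<exists>x\<in>elts (lab t). \<beta> \<in> elts x \<and> t @ [x] \<in> T)))"

text \<open>Moves at nodes labelled \<kappa> are confined to \<delta>: there the branch is to climb
  towards \<delta> instead of \<kappa>.\<close>

definition ceil_at :: "'v \<Rightarrow> 'v \<Rightarrow> 'v list \<Rightarrow> 'v" where
  "ceil_at \<kappa> \<delta> t = (if lab t = \<kappa> then \<delta> else lab t)"

text \<open>
  A game on \<open>T\<close> in which the first player wants \<open>F t \<inter> \<kappa>\<close> to leave \<open>\<delta>\<close>: at a node \<open>t\<close> labelled
  outside \<open>D\<close> he plays a bound \<open>\<sigma> t\<close>, and the second player answers with a successor above it.
  \<open>forced T D \<kappa> \<delta> \<sigma> t\<close> says that \<open>\<sigma>\<close> wins for the first player from \<open>t\<close> on.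
\<close>

inductive forced :: "'v list set \<Rightarrow> 'v set \<Rightarrow> 'v \<Rightarrow> 'v \<Rightarrow> ('v list \<Rightarrow> 'v) \<Rightarrow> 'v list \<Rightarrow> bool"
  for T D \<kappa> \<delta> \<sigma> where
  escape: "\<not> F t \<inter> elts \<kappa> \<subseteq> elts \<delta> \<Longrightarrow> forced T D \<kappa> \<delta> \<sigma> t"
| inside: "lab t \<in> D \<Longrightarrow> (\<And>x. t @ [x] \<in> T \<Longrightarrow> forced T D \<kappa> \<delta> \<sigma> (t @ [x])) \<Longrightarrow> forced T D \<kappa> \<delta> \<sigma> t"
| outside: "lab t \<notin> D \<Longrightarrow> \<sigma> t \<in> elts (ceil_at \<kappa> \<delta> t) \<Longrightarrow>
    (\<And>x. x \<in> elts (ceil_at \<kappa> \<delta> t) \<Longrightarrow> \<sigma> t \<in> elts x \<Longrightarrow> t @ [x] \<in> T \<Longrightarrow> forced T D \<kappa> \<delta> \<sigma> (t @ [x]))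
    \<Longrightarrow> forced T D \<kappa> \<delta> \<sigma> t"

text \<open>A play from t visits only extensions of t, so a strategy may be altered everywhere
  else.\<close>

lemma forced_cong:
  assumes "forced T D \<kappa> \<delta> \<sigma> t" "\<And>w. \<sigma> (t @ w) = \<tau> (t @ w)"
  shows "forced T D \<kappa> \<delta> \<tau> t"
  using assms
proof (induction rule: forced.induct)
  case (escape t)
  then show ?case by (simp add: forced.escape)
next
  case (inside t)
  show ?case
  proof (rule forced.inside[OF inside(1)])
    fix x assume "t @ [x] \<in> T"
    moreover have "\<sigma> ((t @ [x]) @ w) = \<tau> ((t @ [x]) @ w)" for w using inside(4)[of "x # w"] by simp
    ultimately show "forced T D \<kappa> \<delta> \<tau> (t @ [x])" by (rule inside(3))
  qed
next
  case (outside t)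
  have eq: "\<sigma> t = \<tau> t" using outside(5)[of "[]"] by simp
  show ?case
  proof (rule forced.outside[OF outside(1)])
    show "\<tau> t \<in> elts (ceil_at \<kappa> \<delta> t)" using outside(2) eq by simp
    fix x assume x: "x \<in> elts (ceil_at \<kappa> \<delta> t)" "\<tau> t \<in> elts x" "t @ [x] \<in> T"
    have "\<sigma> ((t @ [x]) @ w) = \<tau> ((t @ [x]) @ w)" for w using outside(5)[of "x # w"] by simp
    then show "forced T D \<kappa> \<delta> \<tau> (t @ [x])" using outside(4) x eq by simp
  qed
qed

text \<open>The nodes above different successors of t form disjoint sets, so the strategies there
  can be glued: \<open>u ! length t\<close> tells through which successor u passes. The value at t
  itself remains free.\<close>

lemma forced_amalgamate:
  assumes "\<And>x. P x \<Longrightarrow> \<exists>\<sigma>. forced T D \<kappa> \<delta> \<sigma> (t @ [x])"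
  shows "\<exists>\<sigma>. \<sigma> t = \<beta> \<and> (\<forall>x. P x \<longrightarrow> forced T D \<kappa> \<delta> \<sigma> (t @ [x]))"
proof -
  obtain \<tau> where \<tau>: "\<And>x. P x \<Longrightarrow> forced T D \<kappa> \<delta> (\<tau> x) (t @ [x])" using assms by metis
  define \<sigma> where "\<sigma> u = (if length t < length u then \<tau> (u ! length t) u else \<beta>)" for u
  have "forced T D \<kappa> \<delta> \<sigma> (t @ [x])" if "P x" for x
    by (rule forced_cong[OF \<tau>[OF that]]) (simp add: \<sigma>_def nth_append)
  moreover have "\<sigma> t = \<beta>" by (simp add: \<sigma>_def)
  ultimately show ?thesis by blast
qed

text \<open>
  Strategies \<open>\<sigma> \<delta>\<close> for all \<open>\<delta>\<close> are met at once: where the label exceeds \<open>\<kappa>\<close>, their \<open>\<kappa>\<close> many bounds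
  have a common bound. So a closed set \<open>N\<close> with \<open>N \<inter> \<kappa> = \<delta>\<close> contains a play against \<open>\<sigma> \<delta>\<close>.
\<close>

lemma ex_unforced:
  assumes T: "perfect_off D T" and s: "s \<in> T"
    and r: "regular_cardinal \<kappa>" and u: "uncountable (elts \<kappa>)" and S: "stationary_in S \<kappa>"
  shows "\<exists>\<delta>\<in>S. limit_ord \<delta> \<and> \<not> (\<exists>\<sigma>. forced T D \<kappa> \<delta> \<sigma> s)"
proof (rule ccontr)
  assume "\<not> ?thesis"
  then obtain \<sigma> where \<sigma>: "\<And>\<delta>. \<delta> \<in> S \<Longrightarrow> limit_ord \<delta> \<Longrightarrow> forced T D \<kappa> \<delta> (\<sigma> \<delta>) s" by metis
  have o: "Ord \<kappa>" using r regular_Ord by blast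
  have ol: "Ord (lab t)" for t using regular_lab regular_Ord by blast
  have "\<exists>x. \<kappa> \<in> elts (lab t) \<longrightarrow> t \<in> T \<longrightarrow> lab t \<notin> D \<longrightarrow> x \<in> elts (lab t) \<and> t @ [x] \<in> T \<and>
      (\<forall>\<delta>\<in>elts \<kappa>. \<sigma> \<delta> t \<in> elts (lab t) \<longrightarrow> \<sigma> \<delta> t \<in> elts x)" for t
  proof (cases "\<kappa> \<in> elts (lab t) \<and> t \<in> T \<and> lab t \<notin> D")
    case True
    let ?B = "(\<lambda>\<delta>. \<sigma> \<delta> t) ` elts \<kappa> \<inter> elts (lab t)"
    have "?B \<lesssim> elts \<kappa>" by (meson Int_lower1 image_lepoll lepoll_trans subset_imp_lepoll)
    then obtain \<gamma> where g: "\<gamma> \<in> elts (lab t)" "?B \<subseteq> elts \<gamma>"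
      using regular_bounded[OF regular_lab, of ?B t \<kappa>] True by blast
    then obtain x where x: "x \<in> elts (lab t)" "\<gamma> \<in> elts x" "t @ [x] \<in> T"
      using T True unfolding perfect_off_def by blast
    have "?B \<subseteq> elts x" using g(2) Ord_subset[OF Ord_in_Ord[OF ol x(1)] x(2)] by blast
    then show ?thesis using x by blast
  qed blast
  then obtain x1 where x1: "\<And>t. \<kappa> \<in> elts (lab t) \<Longrightarrow> t \<in> T \<Longrightarrow> lab t \<notin> D \<Longrightarrow> x1 t \<in> elts (lab t) \<and> t @ [x1 t] \<in> T \<and>
      (\<forall>\<delta>\<in>elts \<kappa>. \<sigma> \<delta> t \<in> elts (lab t) \<longrightarrow> \<sigma> \<delta> t \<in> elts (x1 t))" by metis
  define x2 where "x2 t \<beta> = (SOME x. x \<in> elts (lab t) \<and> \<beta> \<in> elts x \<and> t @ [x] \<in> T)" for t \<beta>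
  have x2: "x2 t \<beta> \<in> elts (lab t) \<and> \<beta> \<in> elts (x2 t \<beta>) \<and> t @ [x2 t \<beta>] \<in> T"
    if "t \<in> T" "lab t \<notin> D" "\<beta> \<in> elts (lab t)" for t \<beta>
    unfolding x2_def by (rule someI_ex) (use T that in \<open>auto simp: perfect_off_def\<close>)
  define x3 where "x3 t = (SOME x. t @ [x] \<in> T)" for t
  have x3: "t @ [x3 t] \<in> T" if "t \<in> T" "lab t \<in> D" for t
    unfolding x3_def by (rule someI_ex) (use T that in \<open>auto simp: perfect_off_def\<close>)
  \<comment> \<open>The binary function \<open>x2\<close> enters as an operator at the list
    \<open>t @ [\<beta>]\<close>; hence \<open>butlast\<close> and \<open>last\<close>.\<close>
  define G where "G l = F l \<union> {x1 l, x3 l, x2 (butlast l) (last l)}" for l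
  have cG: "countable (G l)" for l using countable_F by (auto simp: G_def)
  obtain \<delta> N where d: "\<delta> \<in> S" "limit_ord \<delta>" and N: "set s \<subseteq> N" "\<And>l. l \<in> lists N \<Longrightarrow> G l \<subseteq> N"
    "N \<inter> elts \<kappa> = elts \<delta>"
    using stationary_closed_set[of \<kappa> S "set s" G, OF r u S countable_finite[OF finite_set] cG] by blast
  have dk: "\<delta> \<in> elts \<kappa>" using d(1) S by (auto simp: stationary_in_def)
  have od: "Ord \<delta>" using d(2) by (simp add: limit_ord_def)
  have "t \<in> lists N \<Longrightarrow> t \<in> T \<Longrightarrow> False" if "forced T D \<kappa> \<delta> (\<sigma> \<delta>) t" for t
    using that
  proof (induction rule: forced.induct)
    case (escape t)
    have "F t \<subseteq> N" using N(2)[OF escape(2)] by (simp add: G_def)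
    then show ?case using escape N(3) by blast
  next
    case (inside t)
    have "x3 t \<in> N" using N(2)[OF inside(4)] by (simp add: G_def)
    then show ?case using inside(3)[OF x3[OF inside(5,1)]] inside(4) x3[OF inside(5,1)] by simp
  next
    case (outside t)
    have IH: False if "x \<in> elts (ceil_at \<kappa> \<delta> t)" "\<sigma> \<delta> t \<in> elts x" "t @ [x] \<in> T" "x \<in> N" for x
      using outside(4)[OF that(1-3)] outside(5) that(3,4) by simp
    have x2N: "x2 t \<beta> \<in> N" if "\<beta> \<in> N" for \<beta>
      using N(2)[of "t @ [\<beta>]"] outside(5) that by (simp add: G_def)
    \<comment> \<open>If the label is at most \<kappa>, the bound \<sigma> \<delta> t lies in
      \<delta> \<subseteq> N and \<open>x2\<close> answers it inside N. Above \<kappa> the bound may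
      lie outside N, since N need not be closed under \<sigma> \<delta>; \<open>x1\<close> answers
      without reference to \<delta>.\<close>
    consider "lab t = \<kappa>" | "lab t \<in> elts \<kappa>" | "\<kappa> \<in> elts (lab t)" using Ord_linear[OF o ol] by blast
    then show ?case
    proof cases
      case 1
      then have sd: "\<sigma> \<delta> t \<in> elts \<delta>" using outside(2) by (simp add: ceil_at_def)
      then have sN: "\<sigma> \<delta> t \<in> N" "\<sigma> \<delta> t \<in> elts \<kappa>" using N(3) by auto
      note x = x2[OF outside(6,1), of "\<sigma> \<delta> t", unfolded 1, OF sN(2)]
      have "x2 t (\<sigma> \<delta> t) \<in> elts \<delta>" using x2N[OF sN(1)] x N(3) by blast
      then show ?thesis using IH[of "x2 t (\<sigma> \<delta> t)"] x x2N[OF sN(1)] 1 by (simp add: ceil_at_def)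
    next
      case 2
      then have ne: "lab t \<noteq> \<kappa>" using not_in_self by metis
      then have sl: "\<sigma> \<delta> t \<in> elts (lab t)" using outside(2) by (simp add: ceil_at_def)
      have "lab t \<in> N" using N(2)[OF outside(5)] lab_in_F[of t] by (auto simp: G_def)
      then have "lab t \<in> elts \<delta>" using 2 N(3) by blast
      then have "\<sigma> \<delta> t \<in> N" using N(3) Ord_trans[OF od _ sl] by blast
      then show ?thesis using IH[of "x2 t (\<sigma> \<delta> t)"] x2[OF outside(6,1) sl] x2N ne by (simp add: ceil_at_def)
    next
      case 3
      then have ne: "lab t \<noteq> \<kappa>" using not_in_self by metis
      then have sl: "\<sigma> \<delta> t \<in> elts (lab t)" using outside(2) by (simp add: ceil_at_def)
      have "x1 t \<in> N" using N(2)[OF outside(5)] by (simp add: G_def)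
      then show ?thesis using IH[of "x1 t"] x1[OF 3 outside(6,1)] sl dk ne by (simp add: ceil_at_def)
    qed
  qed
  moreover have "s \<in> lists N" using N(1) by (auto simp: in_lists_conv_set)
  ultimately show False using \<sigma>[OF d] s by blast
qed

text \<open>
  The sequence \<open>c\<close> forces the entries of a branch at the nodes labelled \<open>\<kappa>\<close> to be cofinal in \<open>\<delta>\<close>. It is
  only imposed from length \<open>n\<close> on because the stem is already fixed when \<open>\<kappa>\<close> is treated.
\<close>

definition settled :: "'v set \<Rightarrow> 'v \<Rightarrow> 'v list set \<Rightarrow> bool" where
  "settled S \<kappa> T \<longleftrightarrow> (\<exists>\<delta>\<in>S. limit_ord \<delta> \<and> (\<forall>t\<in>T. F t \<inter> elts \<kappa> \<subseteq> elts \<delta>) \<and>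
     (\<exists>(c :: nat \<Rightarrow> 'v) n. (\<forall>\<alpha>\<in>elts \<delta>. \<exists>n. \<forall>m\<ge>n. \<alpha> \<in> elts (c m)) \<and>
        (\<forall>t x. t @ [x] \<in> T \<longrightarrow> n \<le> length t \<longrightarrow> lab t = \<kappa> \<longrightarrow> c (length t) \<in> elts x \<and> x \<in> elts \<delta>)))"

lemma settled_mono: "settled S \<kappa> T \<Longrightarrow> T' \<subseteq> T \<Longrightarrow> settled S \<kappa> T'"
  unfolding settled_def by (elim bexE conjE exE, intro bexI conjI exI) (assumption | blast)+

text \<open>Keep nodes that are not forced. If such a node, labelled outside D, had no unforced
  successor above some bound \<beta> below its ceiling, then gluing the strategies at these
  successors and playing \<beta> first would force the node. So unbounded branching survives at
  labels outside D other than \<kappa>, and at \<kappa> a successor between the value of c and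
  \<delta> remains.\<close>

lemma settle:
  assumes T: "perfect_off D T" and s: "s \<in> T" and k: "\<kappa> \<notin> D"
    and r: "regular_cardinal \<kappa>" and u: "uncountable (elts \<kappa>)" and S: "stationary_in S \<kappa>"
    and cof: "\<And>\<delta>. \<delta> \<in> S \<Longrightarrow> \<exists>E. countable E \<and> cofinal_in E \<delta>"
  shows "\<exists>T'\<subseteq>T. s \<in> T' \<and> perfect_off (insert \<kappa> D) T' \<and> settled S \<kappa> T'"
proof -
  obtain \<delta> where d: "\<delta> \<in> S" "limit_ord \<delta>" "\<not> (\<exists>\<sigma>. forced T D \<kappa> \<delta> \<sigma> s)"
    using ex_unforced[OF T s r u S] by blast
  obtain c :: "nat \<Rightarrow> 'v" where c: "\<And>n. c n \<in> elts \<delta>" "\<forall>\<alpha>\<in>elts \<delta>. \<exists>n. \<forall>m\<ge>n. \<alpha> \<in> elts (c m)"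
    using countable_cofinal_seq[OF d(2)] cof[OF d(1)] by meson
  define W where "W t \<longleftrightarrow> (\<exists>\<sigma>. forced T D \<kappa> \<delta> \<sigma> t)" for t
  define ok where "ok t x \<longleftrightarrow> (length s \<le> length t \<longrightarrow> lab t = \<kappa> \<longrightarrow> c (length t) \<in> elts x \<and> x \<in> elts \<delta>)" for t x
  define T' where "T' = {t \<in> T. \<not> W t \<and> (\<forall>v x w. t = v @ x # w \<longrightarrow> ok v x)}"
  have ext: "t @ [x] \<in> T'" if "t \<in> T'" "t @ [x] \<in> T" "\<not> W (t @ [x])" "ok t x" for t x
    using that unfolding T'_def by (auto simp: append_eq_append_conv2 append_eq_Cons_conv Cons_eq_append_conv)
  have inW: "\<exists>x. t @ [x] \<in> T \<and> \<not> W (t @ [x])" if t: "\<not> W t" "lab t \<in> D" for t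
  proof (rule ccontr)
    assume "\<not> ?thesis"
    then obtain \<sigma> where "\<forall>x. t @ [x] \<in> T \<longrightarrow> forced T D \<kappa> \<delta> \<sigma> (t @ [x])"
      using forced_amalgamate[of "\<lambda>x. t @ [x] \<in> T" T D \<kappa> \<delta> t] unfolding W_def by blast
    then have "forced T D \<kappa> \<delta> \<sigma> t" using forced.inside[OF t(2)] by blast
    then show False using t(1) W_def by blast
  qed
  have outW: "\<exists>x\<in>elts (ceil_at \<kappa> \<delta> t). \<beta> \<in> elts x \<and> t @ [x] \<in> T \<and> \<not> W (t @ [x])"
    if t: "\<not> W t" "lab t \<notin> D" and b: "\<beta> \<in> elts (ceil_at \<kappa> \<delta> t)" for t \<beta>
  proof (rule ccontr)
    assume "\<not> ?thesis"
    then have "\<exists>\<sigma>. \<sigma> t = \<beta> \<and> (\<forall>x. x \<in> elts (ceil_at \<kappa> \<delta> t) \<and> \<beta> \<in> elts x \<and> t @ [x] \<in> T \<longrightarrow> forced T D \<kappa> \<delta> \<sigma> (t @ [x]))"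
      unfolding W_def by (intro forced_amalgamate) blast
    then obtain \<sigma> where \<sigma>: "\<sigma> t = \<beta>" 
      "\<And>x. x \<in> elts (ceil_at \<kappa> \<delta> t) \<Longrightarrow> \<beta> \<in> elts x \<Longrightarrow> t @ [x] \<in> T \<Longrightarrow> forced T D \<kappa> \<delta> \<sigma> (t @ [x])" by blast
    have "forced T D \<kappa> \<delta> \<sigma> t" by (rule forced.outside[OF t(2)]) (use \<sigma> b in auto)
    then show False using t(1) W_def by blast
  qed
  have "perfect_off (insert \<kappa> D) T'"
    unfolding perfect_off_def
  proof (intro ballI conjI impI)
    fix t assume t: "t \<in> T'" and l: "lab t \<in> insert \<kappa> D"
    have nW: "\<not> W t" using t by (simp add: T'_def)
    show "\<exists>x. t @ [x] \<in> T'"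
    proof (cases "lab t = \<kappa>")
      case True
      then have "\<exists>x\<in>elts \<delta>. c (length t) \<in> elts x \<and> t @ [x] \<in> T \<and> \<not> W (t @ [x])"
        using outW[OF nW, of "c (length t)"] c(1) k by (simp add: ceil_at_def)
      then show ?thesis using ext[OF t] ok_def by blast
    next
      case False
      then show ?thesis using inW[OF nW] l ext[OF t] ok_def by blast
    qed
  next
    fix t \<beta> assume t: "t \<in> T'" and l: "lab t \<notin> insert \<kappa> D" and b: "\<beta> \<in> elts (lab t)"
    have nW: "\<not> W t" using t by (simp add: T'_def)
    have "ceil_at \<kappa> \<delta> t = lab t" using l by (simp add: ceil_at_def)
    then have "\<exists>x\<in>elts (lab t). \<beta> \<in> elts x \<and> t @ [x] \<in> T \<and> \<not> W (t @ [x])"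
      using outW[OF nW, of \<beta>] l b by simp
    then show "\<exists>x\<in>elts (lab t). \<beta> \<in> elts x \<and> t @ [x] \<in> T'" using ext[OF t] l ok_def by blast
  qed
  moreover have "settled S \<kappa> T'"
  proof -
    have "F t \<inter> elts \<kappa> \<subseteq> elts \<delta>" if "t \<in> T'" for t
      using that forced.escape[of t \<kappa> \<delta>] unfolding T'_def W_def by blast
    moreover have "c (length t) \<in> elts x \<and> x \<in> elts \<delta>" if "t @ [x] \<in> T'" "length s \<le> length t" "lab t = \<kappa>" for t x
      using that unfolding T'_def ok_def by blast
    ultimately show ?thesis unfolding settled_def using d(1,2) c(2) by blast
  qed
  \<comment> \<open>Proper initial segments of \<open>s\<close> are shorter than \<open>s\<close>,
    so \<open>ok\<close> holds at them vacuously.\<close>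
  moreover have "s \<in> T'"
    using s d(3) unfolding T'_def W_def ok_def by auto
  moreover have "T' \<subseteq> T" unfolding T'_def by blast
  ultimately show ?thesis by blast
qed

text \<open>Fusion: the label of the current stem is settled, then the stem grows by one entry
  inside the thinned tree, so the tail of the branch stays in every tree produced so far. D records
  the cardinals already settled; their unbounded branching is spent, so they are not treated a
  second time.\<close>

lemma ex_branch:
  assumes S: "\<And>t. stationary_in (S (lab t)) (lab t)"
    and cof: "\<And>t \<delta>. \<delta> \<in> S (lab t) \<Longrightarrow> \<exists>E. countable E \<and> cofinal_in E \<delta>"
  shows "\<exists>(s :: nat \<Rightarrow> 'v list) T. (\<forall>n. length (s n) = n \<and> (\<exists>x\<in>elts (lab (s n)). s (Suc n) = s n @ [x])
     \<and> s n \<in> T n \<and> T (Suc n) \<subseteq> T n \<and> settled (S (lab (s n))) (lab (s n)) (T (Suc n)))"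
proof -
  define P where "P n z \<longleftrightarrow> (case z of (s, T, D) \<Rightarrow> s \<in> T \<and> perfect_off D T \<and> length s = n \<and>
     (\<forall>t x. t @ [x] \<in> T \<longrightarrow> x \<in> elts (lab t)) \<and> (\<forall>\<kappa>\<in>D. settled (S \<kappa>) \<kappa> T))"
    for n :: nat and z :: "'v list \<times> 'v list set \<times> 'v set"
  define Q where "Q n z z' \<longleftrightarrow> (case z of (s, T, D) \<Rightarrow> case z' of (s', T', D') \<Rightarrow> T' \<subseteq> T \<and>
     (\<exists>x\<in>elts (lab s). s' = s @ [x]) \<and> settled (S (lab s)) (lab s) T')"
    for n :: nat and z z' :: "'v list \<times> 'v list set \<times> 'v set"
  have "\<exists>f. \<forall>n. P n (f n) \<and> Q n (f n) (f (Suc n))"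
  proof (rule dependent_nat_choice)
    let ?T0 = "{t. \<forall>v x w. t = v @ x # w \<longrightarrow> x \<in> elts (lab v)}"
    have ext: "t @ [x] \<in> ?T0" if "t \<in> ?T0" "x \<in> elts (lab t)" for t x
      using that by (auto simp: append_eq_append_conv2 append_eq_Cons_conv Cons_eq_append_conv)
    have lim: "\<exists>x\<in>elts (lab t). \<beta> \<in> elts x" if "\<beta> \<in> elts (lab t)" for t \<beta>
      using regular_limit[OF regular_lab] that unfolding limit_ord_def by blast
    have "perfect_off {} ?T0" unfolding perfect_off_def
    proof (intro ballI conjI impI)
      fix t \<beta> assume t: "t \<in> ?T0" "\<beta> \<in> elts (lab t)"
      then obtain x where "x \<in> elts (lab t)" "\<beta> \<in> elts x" using lim by blast
      then show "\<exists>x\<in>elts (lab t). \<beta> \<in> elts x \<and> t @ [x] \<in> ?T0" using ext[OF t(1)] by blast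
    qed simp
    then have "P 0 ([], ?T0, {})" unfolding P_def by auto
    then show "\<exists>z. P 0 z" by blast
  next
    fix z n assume z: "P n z"
    obtain s T D where zz: "z = (s, T, D)" by (metis prod_cases3)
    have p: "s \<in> T" "perfect_off D T" "length s = n" "\<And>t x. t @ [x] \<in> T \<Longrightarrow> x \<in> elts (lab t)" 
      "\<And>\<kappa>. \<kappa> \<in> D \<Longrightarrow> settled (S \<kappa>) \<kappa> T" using z unfolding P_def zz by auto
    have "\<exists>T'\<subseteq>T. s \<in> T' \<and> perfect_off (insert (lab s) D) T' \<and> settled (S (lab s)) (lab s) T'"
    proof (cases "lab s \<in> D")
      case True
      then show ?thesis using p by (metis insert_absorb order_refl)
    next
      case False
      show ?thesis by (rule settle[OF p(2,1) False regular_lab uncountable_lab S cof])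
    qed
    then obtain T' where T': "T' \<subseteq> T" "s \<in> T'" "perfect_off (insert (lab s) D) T'" "settled (S (lab s)) (lab s) T'"
      by blast
    then obtain x where x: "s @ [x] \<in> T'" unfolding perfect_off_def by blast
    have "P (Suc n) (s @ [x], T', insert (lab s) D)"
      unfolding P_def using x T' p settled_mono[OF p(5) T'(1)] by auto
    moreover have "Q n z (s @ [x], T', insert (lab s) D)"
      unfolding Q_def zz using x T' p(4) by auto
    ultimately show "\<exists>z'. P (Suc n) z' \<and> Q n z z'" by blast
  qed
  then obtain f where f: "\<And>n. P n (f n)" "\<And>n. Q n (f n) (f (Suc n))" by blast
  have "length (fst (f n)) = n \<and> (\<exists>x\<in>elts (lab (fst (f n))). fst (f (Suc n)) = fst (f n) @ [x]) \<and>
      fst (f n) \<in> fst (snd (f n)) \<and> fst (snd (f (Suc n))) \<subseteq> fst (snd (f n)) \<and>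
      settled (S (lab (fst (f n)))) (lab (fst (f n))) (fst (snd (f (Suc n))))" for n
    using f(1)[of n] f(2)[of n] unfolding P_def Q_def by (auto split: prod.splits)
  then show ?thesis by (intro exI[of _ "\<lambda>n. fst (f n)"] exI[of _ "\<lambda>n. fst (snd (f n))"]) blast
qed

end

text \<open>Each node t carries a member \<open>Y t\<close> of C; a child absorbs the model of its
  parent, one round of closure under G and the new entry, as far as these lie in A. Along a branch
  the union X is in C. For \<kappa> \<in> X \<inter> K, settling keeps X \<inter> \<kappa> inside
  some \<delta> \<in> S \<kappa>, while the entries chosen at nodes labelled \<kappa> belong to X
  and are cofinal in \<delta>. The cardinal \<open>\<kappa>\<^sub>0\<close> lies in every
  \<open>Y t\<close>, so there is always a label to choose.\<close>

theorem cofinality_omega_mutually_stationary: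
  fixes C :: "'v::zfc set" and A :: "'v set" and K :: "'v set" and S :: "'v \<Rightarrow> 'v set" and G :: "'v list \<Rightarrow> 'v set"
  assumes C: "club_ctbl C A" and k0: "\<kappa>\<^sub>0 \<in> K" and KA: "K \<subseteq> A" "\<And>\<kappa>. \<kappa> \<in> K \<Longrightarrow> elts \<kappa> \<subseteq> A"
    and r: "\<And>\<kappa>. \<kappa> \<in> K \<Longrightarrow> regular_cardinal \<kappa>" and u: "\<And>\<kappa>. \<kappa> \<in> K \<Longrightarrow> uncountable (elts \<kappa>)"
    and S: "\<And>\<kappa>. \<kappa> \<in> K \<Longrightarrow> stationary_in (S \<kappa>) \<kappa>"
    and cof: "\<And>\<kappa> \<delta>. \<kappa> \<in> K \<Longrightarrow> \<delta> \<in> S \<kappa> \<Longrightarrow> \<exists>E. countable E \<and> cofinal_in E \<delta>"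
    and G: "\<And>l. countable (G l)"
  shows "\<exists>X\<in>C. \<kappa>\<^sub>0 \<in> elts X \<and> (\<forall>l\<in>lists (elts X). G l \<inter> A \<subseteq> elts X) \<and>
    (\<forall>\<kappa>\<in>elts X \<inter> K. \<exists>\<delta>\<in>S \<kappa>. limit_ord \<delta> \<and> cofinal_in (elts X \<inter> elts \<kappa>) \<delta>)"
proof -
  have CA: "elts y \<subseteq> A" "countable (elts y)" if "y \<in> C" for y
    using C that by (auto simp: club_ctbl_def ctbl_subsets_def)
  have "infinite (elts \<kappa>\<^sub>0)" using u[OF k0] countable_finite by blast
  then have "infinite A" using KA(2)[OF k0] infinite_super by blast
  \<comment> \<open>Members of \<open>ctbl_subsets\<close> are infinite, so E pads a possibly finite
    B.\<close>
  then obtain E where E: "E \<subseteq> A" "infinite E" "countable E" using infinite_countable_subset' by blast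
  have "\<exists>y. countable B \<longrightarrow> y \<in> C \<and> B \<inter> A \<subseteq> elts y" for B
  proof (cases "countable B")
    case True
    have "countable (B \<inter> A \<union> E)" using True E by blast
    then have e: "elts (set_of (B \<inter> A \<union> E)) = B \<inter> A \<union> E" by (rule elts_set_of[OF small_countable])
    have "set_of (B \<inter> A \<union> E) \<in> ctbl_subsets A"
      unfolding ctbl_subsets_def using e E \<open>countable (B \<inter> A \<union> E)\<close> by auto
    then obtain y where "y \<in> C" "B \<inter> A \<union> E \<subseteq> elts y" using C e unfolding club_ctbl_def by metis
    then show ?thesis by blast
  qed blast
  then obtain pick where pick: "\<And>B. countable B \<Longrightarrow> pick B \<in> C \<and> B \<inter> A \<subseteq> elts (pick B)" by metis
  define nxt where "nxt x y = elts y \<union> {x} \<union> (\<Union>l\<in>lists (elts y). G l)" for x y :: 'v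
  define Y where "Y t = foldr (\<lambda>x y. pick (nxt x y)) (rev t) (pick {\<kappa>\<^sub>0})" for t
  have Ynil: "Y [] = pick {\<kappa>\<^sub>0}" by (simp add: Y_def)
  have Ysnoc: "Y (t @ [x]) = pick (nxt x (Y t))" for t x by (simp add: Y_def)
  have cn: "countable (nxt x y)" if "y \<in> C" for x y
    using CA(2)[OF that] G by (auto simp: nxt_def)
  have YC: "Y t \<in> C" for t
    by (induction t rule: rev_induct) (use pick cn in \<open>auto simp: Ynil Ysnoc\<close>)
  have Ysub: "nxt x (Y t) \<inter> A \<subseteq> elts (Y (t @ [x]))" for t x using pick[OF cn[OF YC]] by (simp add: Ysnoc)
  have Ymono: "elts (Y t) \<subseteq> elts (Y (t @ [x]))" for t x
    using Ysub[of x t] CA(1)[OF YC[of t]] unfolding nxt_def by blast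
  have k0Y: "\<kappa>\<^sub>0 \<in> elts (Y t)" for t
  proof (induction t rule: rev_induct)
    case Nil
    then show ?case using pick[of "{\<kappa>\<^sub>0}"] k0 KA(1) unfolding Ynil by auto
  qed (use Ymono in blast)
  define e where "e t = from_nat_into (elts (Y t) \<inter> K)" for t
  have eK: "e t j \<in> elts (Y t) \<inter> K" for t j
    unfolding e_def by (rule from_nat_into) (use k0 k0Y in blast)
  \<comment> \<open>Bookkeeping by the length of t, decoded as (i, (j, m)): the label is the j-th
    cardinal in the model attached to the initial segment of length i, and the free component m
    makes each pair i, j recur infinitely often along a branch.\<close>
  define lab where "lab t = e (take (fst (prod_decode (length t))) t) (fst (prod_decode (snd (prod_decode (length t)))))" for t
  have Ytake: "elts (Y (take i t)) \<subseteq> elts (Y t)" for i t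
  proof (induction t rule: rev_induct)
    case (snoc x t)
    then show ?case using Ymono[of t x] by (cases "i \<le> length t") auto
  qed simp
  have labK: "lab t \<in> elts (Y t) \<inter> K" for t
    using eK[of "take (fst (prod_decode (length t))) t"] Ytake unfolding lab_def by blast
  interpret labelled_tree "\<lambda>t. elts (Y t)" lab
    by unfold_locales (use labK r u CA(2)[OF YC] in auto)
  obtain s T where sT: "\<And>n. length (s n) = n" "\<And>n. \<exists>x\<in>elts (lab (s n)). s (Suc n) = s n @ [x]"
     "\<And>n. s n \<in> T n" "\<And>n. T (Suc n) \<subseteq> T n" "\<And>n. settled (S (lab (s n))) (lab (s n)) (T (Suc n))"
    using ex_branch[of S] S cof labK by (metis IntE)
  have Tm: "T n \<subseteq> T m" if "m \<le> n" for m n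
    using that sT(4) by (rule lift_Suc_antimono_le[rotated])
  have mono1: "elts (Y (s n)) \<subseteq> elts (Y (s (Suc n)))" for n using sT(2)[of n] Ymono by metis
  have Ys: "elts (Y (s m)) \<subseteq> elts (Y (s n))" if "m \<le> n" for m n
    using mono1 that by (rule lift_Suc_mono_le)
  have stake: "take m (s n) = s m" if "m \<le> n" for m n
    using that
  proof (induction n rule: dec_induct)
    case base
    then show ?case using sT(1)[of m] by simp
  next
    case (step n)
    obtain x where "s (Suc n) = s n @ [x]" using sT(2) by blast
    then show ?case using step sT(1)[of n] by simp
  qed
  have often: "\<exists>k\<ge>m. lab (s k) = \<kappa>" if k: "\<kappa> \<in> elts (Y (s i)) \<inter> K" for \<kappa> i m
  proof -
    have "countable (elts (Y (s i)) \<inter> K)" using CA(2)[OF YC] by blast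
    then obtain j where j: "\<kappa> = e (s i) j" using from_nat_into_surj[OF _ k] unfolding e_def by metis
    define k where "k = prod_encode (i, prod_encode (j, m))"
    have "m \<le> k" "i \<le> k" unfolding k_def
      using le_prod_encode_1 le_prod_encode_2 order_trans by metis+
    then show ?thesis using j stake[of i k] sT(1)[of k] by (intro exI[of _ k]) (simp add: lab_def k_def)
  qed
  define X where "X = set_of (\<Union>n. elts (Y (s n)))"
  have "X \<in> C" unfolding X_def
    using C[unfolded club_ctbl_def, THEN conjunct2, THEN conjunct2, THEN spec, of "\<lambda>n. Y (s n)"] YC mono1
    by simp
  have "countable (\<Union>n. elts (Y (s n)))" using CA(2)[OF YC] by blast
  then have eX: "elts X = (\<Union>n. elts (Y (s n)))" unfolding X_def by (rule elts_set_of[OF small_countable])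
  have xX: "s (Suc n) = s n @ [x] \<Longrightarrow> x \<in> elts X" for n x
  proof -
    assume sx: "s (Suc n) = s n @ [x]"
    then have "x \<in> A" using sT(2)[of n] KA(2) labK by auto
    then have "x \<in> elts (Y (s (Suc n)))" unfolding sx using Ysub[of x "s n"] by (auto simp: nxt_def)
    then show ?thesis using eX by blast
  qed
  have "G l \<inter> A \<subseteq> elts X" if l: "l \<in> lists (elts X)" for l
  proof -
    obtain n where n: "l \<in> lists (elts (Y (s n)))" 
      using lists_incseq_UN[of "\<lambda>n. elts (Y (s n))", OF mono1] l unfolding eX by blast
    obtain x where x: "s (Suc n) = s n @ [x]" using sT(2) by blast
    have "G l \<inter> A \<subseteq> elts (Y (s (Suc n)))" using Ysub[of x "s n"] n unfolding x nxt_def by blast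
    then show ?thesis using eX by blast
  qed
  moreover have "\<exists>\<delta>\<in>S \<kappa>. limit_ord \<delta> \<and> cofinal_in (elts X \<inter> elts \<kappa>) \<delta>" if k: "\<kappa> \<in> elts X \<inter> K" for \<kappa>
  proof -
    obtain i where i: "\<kappa> \<in> elts (Y (s i)) \<inter> K" using k eX by blast
    obtain m where m: "lab (s m) = \<kappa>" using often[OF i] by blast
    have "settled (S \<kappa>) \<kappa> (T (Suc m))" using sT(5)[of m] m by simp
    then obtain \<delta> c n where d: "\<delta> \<in> S \<kappa>" "limit_ord \<delta>" "\<And>t. t \<in> T (Suc m) \<Longrightarrow> elts (Y t) \<inter> elts \<kappa> \<subseteq> elts \<delta>"
      and c: "\<forall>\<alpha>\<in>elts \<delta>. \<exists>n::nat. \<forall>m\<ge>n. \<alpha> \<in> elts (c m)"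
      and b: "\<And>t x. t @ [x] \<in> T (Suc m) \<Longrightarrow> n \<le> length t \<Longrightarrow> lab t = \<kappa> \<Longrightarrow> c (length t) \<in> elts x \<and> x \<in> elts \<delta>"
      unfolding settled_def by metis
    have dk: "\<delta> \<in> elts \<kappa>" using S d(1) k by (auto simp: stationary_in_def)
    have sub: "elts X \<inter> elts \<kappa> \<subseteq> elts \<delta>"
    proof
      fix y assume y: "y \<in> elts X \<inter> elts \<kappa>"
      then obtain j where "y \<in> elts (Y (s j))" using eX by blast
      then have "y \<in> elts (Y (s (max j (Suc m))))" using Ys[of j "max j (Suc m)"] by auto
      moreover have "s (max j (Suc m)) \<in> T (Suc m)" using sT(3) Tm[of "Suc m" "max j (Suc m)"] by auto
      ultimately show "y \<in> elts \<delta>" using d(3) y by blast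
    qed
    have "\<exists>\<beta>\<in>elts X \<inter> elts \<kappa>. elts \<alpha> \<subseteq> elts \<beta>" if a: "\<alpha> \<in> elts \<delta>" for \<alpha>
    proof -
      obtain n1 where n1: "\<And>m. m \<ge> n1 \<Longrightarrow> \<alpha> \<in> elts (c m)" using c a by blast
      \<comment> \<open>j lies beyond the point where c stays above \<alpha>, beyond the level n
        from which the constraint by c holds, and late enough for the branch to have entered the
        tree that settled \<kappa>.\<close>
      obtain j where j: "j \<ge> max n1 (max n (Suc m))" "lab (s j) = \<kappa>" using often[OF i] by blast
      obtain x where x: "s (Suc j) = s j @ [x]" using sT(2) by blast
      have "s (Suc j) \<in> T (Suc m)" using sT(3) Tm[of "Suc m" "Suc j"] j(1) by auto
      then have cx: "c j \<in> elts x" "x \<in> elts \<delta>" using b[of "s j" x] x j sT(1)[of j] by auto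
      have ok: "Ord \<kappa>" using r k regular_Ord by blast
      have xk: "x \<in> elts \<kappa>" using Ord_trans[OF ok dk cx(2)] .
      have "Ord x" using Ord_in_Ord[OF ok xk] .
      then have "\<alpha> \<in> elts x" using Ord_trans[OF _ cx(1)] n1 j(1) by auto
      then have "elts \<alpha> \<subseteq> elts x" using Ord_subset \<open>Ord x\<close> by blast
      then show ?thesis using xX[OF x] xk by blast
    qed
    then show ?thesis using d sub unfolding cofinal_in_def by blast
  qed
  moreover have "\<kappa>\<^sub>0 \<in> elts X" using k0Y eX by blast
  ultimately show ?thesis using \<open>X \<in> C\<close> by blast
qed

section \<open>Splitting stationary subsets of \<open>\<omega>\<^sub>1\<close>\<close>

lemma stationary_superset: "stationary_in A \<kappa> \<Longrightarrow> A \<subseteq> B \<Longrightarrow> B \<subseteq> elts \<kappa> \<Longrightarrow> stationary_in B \<kappa>"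
  unfolding stationary_in_def by (meson disjoint_iff subsetD)

text \<open>Cutting off a bounded part of a club leaves a club.\<close>

lemma stationary_above:
  assumes l: "limit_ord \<kappa>" and T: "stationary_in T \<kappa>" and b: "\<beta> \<in> elts \<kappa>"
  shows "stationary_in {\<alpha> \<in> T. \<beta> \<in> elts \<alpha>} \<kappa>"
proof -
  have o: "Ord \<kappa>" using l by (simp add: limit_ord_def)
  have "\<exists>\<alpha>\<in>T. \<beta> \<in> elts \<alpha> \<and> \<alpha> \<in> C" if C: "club_in C \<kappa>" for C
  proof -
    let ?C = "{\<gamma> \<in> C. \<beta> \<in> elts \<gamma>}"
    have Ck: "C \<subseteq> elts \<kappa>" and Cc: "\<And>\<alpha>. \<alpha> \<in> elts \<kappa> \<Longrightarrow> \<exists>\<beta>\<in>C. elts \<alpha> \<subseteq> elts \<beta>"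
      and Cl: "\<And>\<alpha>. \<alpha> \<in> elts \<kappa> \<Longrightarrow> limit_ord \<alpha> \<Longrightarrow> cofinal_in (C \<inter> elts \<alpha>) \<alpha> \<Longrightarrow> \<alpha> \<in> C"
      using C unfolding club_in_def cofinal_in_def by auto
    have cof: "\<exists>\<gamma>\<in>?C. elts \<alpha> \<subseteq> elts \<gamma>" if a: "\<alpha> \<in> elts \<kappa>" for \<alpha>
    proof -
      obtain \<gamma> where g: "\<gamma> \<in> elts \<kappa>" "\<alpha> \<in> elts \<gamma>" "\<beta> \<in> elts \<gamma>" using limit_ord_two[OF l a b] by blast
      obtain \<xi> where x: "\<xi> \<in> C" "elts \<gamma> \<subseteq> elts \<xi>" using Cc[OF g(1)] by blast
      have "elts \<alpha> \<subseteq> elts \<gamma>" using Ord_subset Ord_in_Ord[OF o] g by blast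
      then show ?thesis using x g by blast
    qed
    have cl: "\<alpha> \<in> ?C" if a: "\<alpha> \<in> elts \<kappa>" "limit_ord \<alpha>" and c: "cofinal_in (?C \<inter> elts \<alpha>) \<alpha>" for \<alpha>
    proof -
      have "cofinal_in (C \<inter> elts \<alpha>) \<alpha>" using c unfolding cofinal_in_def by blast
      then have "\<alpha> \<in> C" using Cl a by blast
      obtain \<xi> where "\<xi> \<in> elts \<alpha>" using a(2) by (auto simp: limit_ord_def)
      then obtain \<gamma> where "\<gamma> \<in> ?C \<inter> elts \<alpha>" using c unfolding cofinal_in_def by blast
      then have "\<beta> \<in> elts \<alpha>" using Ord_trans Ord_in_Ord[OF o a(1)] by blast
      then show ?thesis using \<open>\<alpha> \<in> C\<close> by blast
    qed
    have "?C \<subseteq> elts \<kappa>" using Ck by blast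
    then have "club_in ?C \<kappa>" unfolding club_in_def cofinal_in_def[of ?C \<kappa>] using cof cl by simp
    then have "T \<inter> ?C \<noteq> {}" using T unfolding stationary_in_def by blast
    then show ?thesis by blast
  qed
  moreover have "T \<subseteq> elts \<kappa>" using T by (simp add: stationary_in_def)
  ultimately show ?thesis unfolding stationary_in_def by blast
qed

lemma stationary_in_self: "limit_ord \<kappa> \<Longrightarrow> stationary_in (elts \<kappa>) \<kappa>"
  unfolding stationary_in_def club_in_def cofinal_in_def limit_ord_def by blast

text \<open>Fodor's lemma. If all fibres are nonstationary, the fibre over i misses a club C i.
  \<open>h\<close> bounds, for all i < \<alpha>, the chosen element of C i above \<alpha>, so a
  closure point \<delta> of \<open>h\<close> is a limit of every C i with i < \<delta>; i = f
  \<delta> gives the contradiction. Closure points take the place of the diagonal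
  intersection.\<close>

lemma pressing_down:
  assumes r: "regular_cardinal \<kappa>" and u: "uncountable (elts \<kappa>)" and T: "stationary_in T \<kappa>"
    and f: "\<And>\<alpha>. \<alpha> \<in> T \<Longrightarrow> f \<alpha> \<in> elts \<alpha>"
  shows "\<exists>i\<in>elts \<kappa>. stationary_in {\<alpha> \<in> T. f \<alpha> = i} \<kappa>"
proof (rule ccontr)
  assume n: "\<not> ?thesis"
  have o: "Ord \<kappa>" and l: "limit_ord \<kappa>" using r regular_Ord regular_limit by auto
  have Tk: "T \<subseteq> elts \<kappa>" using T by (simp add: stationary_in_def)
  have "\<exists>C. i \<in> elts \<kappa> \<longrightarrow> club_in C \<kappa> \<and> {\<alpha> \<in> T. f \<alpha> = i} \<inter> C = {}" for i
    using n Tk unfolding stationary_in_def by blast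
  then obtain C where C: "\<And>i. i \<in> elts \<kappa> \<Longrightarrow> club_in (C i) \<kappa>" "\<And>i. i \<in> elts \<kappa> \<Longrightarrow> {\<alpha> \<in> T. f \<alpha> = i} \<inter> C i = {}"
    by metis
  have "\<exists>\<gamma>\<in>C i. \<alpha> \<in> elts \<gamma>" if "i \<in> elts \<kappa>" "\<alpha> \<in> elts \<kappa>" for i \<alpha>
    using cofinal_in_limit[OF l, of "C i"] C(1)[OF that(1)] that(2) unfolding club_in_def by blast
  then obtain nx where nx: "\<And>i \<alpha>. i \<in> elts \<kappa> \<Longrightarrow> \<alpha> \<in> elts \<kappa> \<Longrightarrow> nx i \<alpha> \<in> C i \<and> \<alpha> \<in> elts (nx i \<alpha>)" by metis
  have "\<exists>\<beta>\<in>elts \<kappa>. (\<lambda>i. nx i \<alpha>) ` elts \<alpha> \<subseteq> elts \<beta>" if a: "\<alpha> \<in> elts \<kappa>" for \<alpha>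
  proof (rule regular_bounded[OF r _ image_lepoll a])
    show "(\<lambda>i. nx i \<alpha>) ` elts \<alpha> \<subseteq> elts \<kappa>"
    proof
      fix y assume "y \<in> (\<lambda>i. nx i \<alpha>) ` elts \<alpha>"
      then obtain i where i: "i \<in> elts \<alpha>" "y = nx i \<alpha>" by blast
      then have ik: "i \<in> elts \<kappa>" using Ord_trans[OF o a] by blast
      then show "y \<in> elts \<kappa>" using nx[OF ik a] C(1)[OF ik] i(2) unfolding club_in_def cofinal_in_def by blast
    qed
  qed
  then obtain h where h: "\<And>\<alpha>. \<alpha> \<in> elts \<kappa> \<Longrightarrow> h \<alpha> \<in> elts \<kappa> \<and> (\<lambda>i. nx i \<alpha>) ` elts \<alpha> \<subseteq> elts (h \<alpha>)" by metis
  obtain \<delta> where d: "\<delta> \<in> T" "limit_ord \<delta>" "\<forall>\<alpha>\<in>elts \<delta>. h \<alpha> \<in> elts \<delta>"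
    using stationary_closure_point[OF r u T, of h] h by blast
  have dk: "\<delta> \<in> elts \<kappa>" using d(1) Tk by blast
  have od: "Ord \<delta>" using d(2) by (simp add: limit_ord_def)
  define i where "i = f \<delta>"
  have i: "i \<in> elts \<delta>" "i \<in> elts \<kappa>" using f[OF d(1)] Ord_trans[OF o dk] unfolding i_def by blast+
  have "\<exists>\<beta>\<in>C i \<inter> elts \<delta>. elts \<alpha> \<subseteq> elts \<beta>" if a: "\<alpha> \<in> elts \<delta>" for \<alpha>
  proof -
    obtain \<gamma> where g: "\<gamma> \<in> elts \<delta>" "\<alpha> \<in> elts \<gamma>" "i \<in> elts \<gamma>" using limit_ord_two[OF d(2) a i(1)] by blast
    have gk: "\<gamma> \<in> elts \<kappa>" using g Ord_trans[OF o dk] by blast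
    have "nx i \<gamma> \<in> elts (h \<gamma>)" using h[OF gk] g by blast
    then have nd: "nx i \<gamma> \<in> elts \<delta>" using d(3) g Ord_trans[OF od] by blast
    have "Ord (nx i \<gamma>)" using nd Ord_in_Ord od by blast
    then have "elts \<alpha> \<subseteq> elts (nx i \<gamma>)" using nx[OF i(2) gk] g Ord_trans by blast
    then show ?thesis using nd nx[OF i(2) gk] by blast
  qed
  then have "cofinal_in (C i \<inter> elts \<delta>) \<delta>" unfolding cofinal_in_def by blast
  then have "\<delta> \<in> C i" using C(1)[OF i(2)] d(2) dk unfolding club_in_def by blast
  then show False using C(2)[OF i(2)] d(1) i_def by blast
qed

text \<open>Coding the colours by elements of \<omega> makes the colouring regressive above
  \<omega>.\<close>

lemma stationary_countable_partition:
  fixes f :: "'v::zfc \<Rightarrow> nat"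
  assumes r: "regular_cardinal \<kappa>" and u: "uncountable (elts \<kappa>)" and T: "stationary_in T \<kappa>"
  shows "\<exists>n. stationary_in {\<alpha> \<in> T. f \<alpha> = n} \<kappa>"
proof -
  obtain e :: "nat \<Rightarrow> 'v" where e: "inj e" "range e \<subseteq> elts omega"
    using infinite_omega unfolding infinite_iff_countable_subset by blast
  have o: "Ord \<kappa>" and l: "limit_ord \<kappa>" using r regular_Ord regular_limit by auto
  let ?T = "{\<alpha> \<in> T. omega \<in> elts \<alpha>}"
  have T': "stationary_in ?T \<kappa>" using stationary_above[OF l T] omega_in_uncountable[OF o u] by blast
  have "e (f \<alpha>) \<in> elts \<alpha>" if "\<alpha> \<in> ?T" for \<alpha>
  proof -
    have "Ord \<alpha>" using that T' Ord_in_Ord[OF o] unfolding stationary_in_def by blast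
    then show ?thesis using Ord_trans[of \<alpha> omega "e (f \<alpha>)"] e(2) that by blast
  qed
  from pressing_down[OF r u T', of "\<lambda>\<alpha>. e (f \<alpha>)", OF this]
  obtain i where i: "i \<in> elts \<kappa>" "stationary_in {\<alpha> \<in> ?T. e (f \<alpha>) = i} \<kappa>" by blast
  have "club_in (elts \<kappa>) \<kappa>" unfolding club_in_def cofinal_in_def by auto
  then obtain \<alpha> where "e (f \<alpha>) = i" using i(2) unfolding stationary_in_def by blast
  then have "{\<alpha> \<in> ?T. e (f \<alpha>) = i} \<subseteq> {\<xi> \<in> T. f \<xi> = f \<alpha>}" using e(1) by (auto dest: injD)
  moreover have "{\<xi> \<in> T. f \<xi> = f \<alpha>} \<subseteq> elts \<kappa>" using T unfolding stationary_in_def by blast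
  ultimately show ?thesis using stationary_superset[OF i(2)] by blast
qed

text \<open>
  An Ulam matrix yields \<open>\<omega>\<^sub>1\<close> disjoint stationary sets; shrinking the \<open>i\<close>-th one to ordinals above \<open>i\<close>
  makes the index map \<open>p\<close> regressive, so that every stationary set has a stationary trace on some fibre.
\<close>

lemma ex_stationary_partition:
  "\<exists>p :: 'v::zfc \<Rightarrow> 'v. (\<forall>\<alpha>\<in>elts omega1. p \<alpha> \<in> elts omega1) \<and>
     (\<forall>i\<in>elts omega1. stationary_in {\<alpha> \<in> elts omega1. p \<alpha> = i} omega1) \<and>
     (\<forall>T. stationary_in T omega1 \<longrightarrow> (\<exists>i\<in>elts omega1. stationary_in {\<alpha> \<in> T. p \<alpha> = i} omega1))"
proof -
  let ?w = "omega1 :: 'v"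
  have r: "regular_cardinal ?w" and u: "uncountable (elts ?w)" by (rule regular_omega1 uncountable_omega1)+
  have o: "Ord ?w" and l: "limit_ord ?w" using r regular_Ord regular_limit by auto
  define f where "f \<alpha> = to_nat_on (elts \<alpha>)" for \<alpha> :: 'v
  have f: "inj_on (f \<alpha>) (elts \<alpha>)" if "\<alpha> \<in> elts ?w" for \<alpha>
    unfolding f_def using countable_in_omega1[OF that] by (rule inj_on_to_nat_on)
  have "\<exists>n. \<xi> \<in> elts ?w \<longrightarrow> stationary_in {\<alpha> \<in> {\<alpha> \<in> elts ?w. \<xi> \<in> elts \<alpha>}. f \<alpha> \<xi> = n} ?w" for \<xi>
    using stationary_countable_partition[OF r u stationary_above[OF l stationary_in_self[OF l], of \<xi>], of "\<lambda>\<alpha>. f \<alpha> \<xi>"]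
    by blast
  then obtain n where n: "\<And>\<xi>. \<xi> \<in> elts ?w \<Longrightarrow> stationary_in {\<alpha> \<in> {\<alpha> \<in> elts ?w. \<xi> \<in> elts \<alpha>}. f \<alpha> \<xi> = n \<xi>} ?w"
    by metis
  \<comment> \<open>The entry of the matrix in row m and column \<xi> consists of the \<alpha> >
    \<xi> with f \<alpha> \<xi> = m. Column \<xi> has a stationary entry in row n \<xi>, and by
    counting one row has uncountably many of these.\<close>
  have "\<exists>m. uncountable {\<xi> \<in> elts ?w. n \<xi> = m}"
  proof (rule ccontr)
    assume "\<not> ?thesis"
    then have "countable (\<Union>m. {\<xi> \<in> elts ?w. n \<xi> = m})" by (intro countable_UN) auto
    moreover have "elts ?w \<subseteq> (\<Union>m. {\<xi> \<in> elts ?w. n \<xi> = m})" by blast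
    ultimately show False using u countable_subset by blast
  qed
  then obtain m where m: "uncountable {\<xi> \<in> elts ?w. n \<xi> = m}" by blast
  define B where "B = {\<xi> \<in> elts ?w. n \<xi> = m}"
  have "B \<lesssim> elts ?w" unfolding B_def by (rule subset_imp_lepoll) blast
  then obtain \<beta> :: 'v where b: "Ord \<beta>" "elts \<beta> \<approx> B" using ex_Ord_eqpoll by blast
  have "uncountable (elts \<beta>)" using m b(2) countable_eqpoll eqpoll_sym unfolding B_def by blast
  then have "\<beta> \<notin> elts ?w" using countable_in_omega1 by blast
  then have "elts ?w \<subseteq> elts \<beta>" using Ord_not_in_iff[OF b(1) o] by blast
  then have "elts ?w \<lesssim> B" using b(2) eqpoll_imp_lepoll lepoll_trans subset_imp_lepoll by blast
  then obtain g where g: "elts ?w \<subseteq> g ` B" by (auto simp: lepoll_iff)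
  \<comment> \<open>Injectivity of f \<alpha> leaves at most one such \<xi>. The map g renames the
    columns in B by all of \<omega>1, and g \<xi> \<in> \<alpha> puts \<alpha> above its index.
    Where no \<xi> exists, the default \<omega> still keeps p regressive at all \<alpha> >
    \<omega>.\<close>
  define P where "P \<alpha> \<xi> \<longleftrightarrow> \<xi> \<in> B \<inter> elts \<alpha> \<and> f \<alpha> \<xi> = m \<and> g \<xi> \<in> elts \<alpha>" for \<alpha> \<xi>
  define p where "p \<alpha> = (if \<exists>\<xi>. P \<alpha> \<xi> then g (SOME \<xi>. P \<alpha> \<xi>) else omega)" for \<alpha>
  have p: "p \<alpha> = g \<xi>" if "\<alpha> \<in> elts ?w" "P \<alpha> \<xi>" for \<alpha> \<xi>
  proof -
    have "P \<alpha> (SOME \<xi>. P \<alpha> \<xi>)" using that(2) by (rule someI)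
    then have "(SOME \<xi>. P \<alpha> \<xi>) = \<xi>" using that f[OF that(1)] unfolding P_def by (auto dest: inj_onD)
    then show ?thesis using that(2) by (auto simp: p_def)
  qed
  have reg: "p \<alpha> \<in> elts \<alpha> \<or> p \<alpha> = omega" for \<alpha>
  proof (cases "\<exists>\<xi>. P \<alpha> \<xi>")
    case True
    then have "P \<alpha> (SOME \<xi>. P \<alpha> \<xi>)" by (rule someI_ex)
    then have "g (SOME \<xi>. P \<alpha> \<xi>) \<in> elts \<alpha>" by (simp only: P_def)
    then show ?thesis using True by (simp add: p_def)
  qed (simp add: p_def)
  have "p \<alpha> \<in> elts ?w" if "\<alpha> \<in> elts ?w" for \<alpha>
    using reg[of \<alpha>] omega_in_omega1 Ord_trans[OF o that] by auto
  moreover have "stationary_in {\<alpha> \<in> elts ?w. p \<alpha> = i} ?w" if i: "i \<in> elts ?w" for i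
  proof -
    obtain \<xi> where x: "\<xi> \<in> B" "g \<xi> = i" using g i by auto
    have xw: "\<xi> \<in> elts ?w" "n \<xi> = m" using x by (auto simp: B_def)
    let ?A = "{\<alpha> \<in> {\<alpha> \<in> {\<alpha> \<in> elts ?w. \<xi> \<in> elts \<alpha>}. f \<alpha> \<xi> = n \<xi>}. i \<in> elts \<alpha>}"
    have "stationary_in ?A ?w" by (rule stationary_above[OF l n[OF xw(1)] i])
    moreover have "?A \<subseteq> {\<alpha> \<in> elts ?w. p \<alpha> = i}"
    proof
      fix \<alpha> assume a: "\<alpha> \<in> ?A"
      then have "P \<alpha> \<xi>" using x xw by (auto simp: P_def)
      then show "\<alpha> \<in> {\<alpha> \<in> elts ?w. p \<alpha> = i}" using p a x by auto
    qed
    ultimately show ?thesis using stationary_superset by blast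
  qed
  moreover have "\<exists>i\<in>elts ?w. stationary_in {\<alpha> \<in> T. p \<alpha> = i} ?w" if T: "stationary_in T ?w" for T
  proof -
    let ?T = "{\<alpha> \<in> T. omega \<in> elts \<alpha>}"
    have "stationary_in ?T ?w" by (rule stationary_above[OF l T omega_in_omega1])
    moreover have "p \<alpha> \<in> elts \<alpha>" if "\<alpha> \<in> ?T" for \<alpha> using reg[of \<alpha>] that by auto
    ultimately obtain i where i: "i \<in> elts ?w" "stationary_in {\<alpha> \<in> ?T. p \<alpha> = i} ?w"
      using pressing_down[OF r u, of ?T p] by blast
    have "{\<alpha> \<in> T. p \<alpha> = i} \<subseteq> elts ?w" using T unfolding stationary_in_def by blast
    then have "stationary_in {\<alpha> \<in> T. p \<alpha> = i} ?w" by (intro stationary_superset[OF i(2)]) auto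
    then show ?thesis using i(1) by blast
  qed
  ultimately show ?thesis by blast
qed

section \<open>Skolem functions\<close>

instance tm :: countable by countable_datatype
instance fm :: countable by countable_datatype

lemma map_eval_tm_cong:
  assumes "\<And>t. t \<in> set ts \<Longrightarrow> \<exists>k. \<forall>s s'. (\<forall>i<k. s i = s' i) \<longrightarrow> eval_tm A s t = eval_tm A s' t"
  shows "\<exists>k. \<forall>s s'. (\<forall>i<k. s i = s' i) \<longrightarrow> map (eval_tm A s) ts = map (eval_tm A s') ts"
  using assms
proof (induction ts)
  case (Cons t ts)
  have "\<exists>k. \<forall>s s'. (\<forall>i<k. s i = s' i) \<longrightarrow> map (eval_tm A s) ts = map (eval_tm A s') ts"
    by (rule Cons.IH) (simp add: Cons.prems)
  then obtain k where k: "\<And>s s'. (\<forall>i<k. s i = s' i) \<Longrightarrow> map (eval_tm A s) ts = map (eval_tm A s') ts"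
    by blast
  obtain j where j: "\<And>s s'. (\<forall>i<j. s i = s' i) \<Longrightarrow> eval_tm A s t = eval_tm A s' t"
    using Cons.prems[of t] by auto
  have "map (eval_tm A s) (t # ts) = map (eval_tm A s') (t # ts)" if "\<forall>i<max k j. s i = s' i" for s s'
    using k[of s s'] j[of s s'] that by simp
  then show ?case by blast
qed auto

lemma eval_tm_cong: "\<exists>k. \<forall>s s'. (\<forall>i<k. s i = s' i) \<longrightarrow> eval_tm A s t = eval_tm A s' t"
proof (induction t)
  case (Var n)
  then show ?case by (intro exI[of _ "Suc n"]) auto
next
  case (App f ts)
  then show ?case using map_eval_tm_cong[of ts A] by (metis eval_tm.simps(2))
qed

text \<open>This takes the place of free variables: truth depends on finitely many values of the
  assignment, so parameters can be passed as a finite list.\<close>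

lemma sat_cong: "\<exists>k. \<forall>s s'. (\<forall>i<k. s i = s' i) \<longrightarrow> sat A s p = sat A s' p"
proof (induction p)
  case (Eq t u)
  obtain j k where "\<And>s s'. (\<forall>i<j. s i = s' i) \<Longrightarrow> eval_tm A s t = eval_tm A s' t"
    "\<And>s s'. (\<forall>i<k. s i = s' i) \<Longrightarrow> eval_tm A s u = eval_tm A s' u"
    using eval_tm_cong[of A] by metis
  then have "\<forall>s s'. (\<forall>i<max j k. s i = s' i) \<longrightarrow> sat A s (Eq t u) = sat A s' (Eq t u)"
    by (metis less_max_iff_disj sat.simps(1))
  then show ?case by blast
next
  case (Rel r ts)
  obtain k where k: "\<And>s s'. (\<forall>i<k. s i = s' i) \<Longrightarrow> map (eval_tm A s) ts = map (eval_tm A s') ts"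
    using map_eval_tm_cong[of ts A, OF eval_tm_cong] by blast
  have "sat A s (Rel r ts) = sat A s' (Rel r ts)" if "\<forall>i<k. s i = s' i" for s s'
    using k[OF that] by (simp only: sat.simps)
  then show ?case by blast
next
  case (Conj p q)
  then obtain j k where "\<And>s s'. (\<forall>i<j. s i = s' i) \<Longrightarrow> sat A s p = sat A s' p"
    "\<And>s s'. (\<forall>i<k. s i = s' i) \<Longrightarrow> sat A s q = sat A s' q" by metis
  then have "\<forall>s s'. (\<forall>i<max j k. s i = s' i) \<longrightarrow> sat A s (Conj p q) = sat A s' (Conj p q)"
    by (metis less_max_iff_disj sat.simps(4))
  then show ?case by blast
next
  case (Exists n p)
  then obtain k where k: "\<And>s s'. (\<forall>i<k. s i = s' i) \<Longrightarrow> sat A s p = sat A s' p" by metis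
  have "sat A (s(n := x)) p = sat A (s'(n := x)) p" if "\<forall>i<k. s i = s' i" for s s' x
    by (rule k) (use that in auto)
  then show ?case by (intro exI[of _ k]) auto
qed auto

lemma eval_tm_univ [simp]: "eval_tm (A\<lparr>univ := N\<rparr>) s t = eval_tm A s t"
proof (induction t)
  case (App f ts)
  then have "map (eval_tm (A\<lparr>univ := N\<rparr>) s) ts = map (eval_tm A s) ts" by simp
  then show ?case by (simp only: eval_tm.simps) simp
qed simp

text \<open>The Tarski-Vaught test, with the formula as an index and the parameters as a list;
  \<open>Sk l\<close> is countable because there are countably many formulas. It is intersected with
  \<open>univ A\<close> since \<open>wit\<close> is arbitrary where no witness exists.\<close>

lemma ex_skolem_functions:
  assumes A: "is_algebra A"
  shows "\<exists>Sk. (\<forall>l. countable (Sk l)) \<and>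
    (\<forall>N. N \<subseteq> univ A \<and> N \<noteq> {} \<and> (\<forall>l\<in>lists N. Sk l \<inter> univ A \<subseteq> N) \<longrightarrow> elem_sub N A)"
proof -
  \<comment> \<open>The filler \<open>undefined\<close> beyond the end of the list is harmless: by
    \<open>sat_cong\<close> a list that is long enough for the formula determines its truth
    value.\<close>
  define asg where "asg l i = (if i < length l then l ! i else undefined)" for l :: "'a list" and i :: nat
  define wit where "wit l n p = (SOME x. x \<in> univ A \<and> sat A ((asg l)(n := x)) p)" for l n p
  define Sk where "Sk l = range (\<lambda>f. opn A f l) \<union> range (\<lambda>(n, p). wit l n p)" for l
  have "countable (Sk l)" for l by (simp add: Sk_def)
  moreover have "elem_sub N A" if N: "N \<subseteq> univ A" "N \<noteq> {}" and cl: "\<And>l. l \<in> lists N \<Longrightarrow> Sk l \<inter> univ A \<subseteq> N" for N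
  proof -
    have "opn A f xs \<in> N" if x: "set xs \<subseteq> N" for f xs
    proof -
      have "opn A f xs \<in> univ A" using A x N(1) by (auto simp: is_algebra_def)
      moreover have "xs \<in> lists N" using x by (auto simp: in_lists_conv_set)
      ultimately show ?thesis using cl[of xs] by (auto simp: Sk_def)
    qed
    then have alg: "is_algebra (A\<lparr>univ := N\<rparr>)" using N(2) by (simp add: is_algebra_def)
    have "sat (A\<lparr>univ := N\<rparr>) s p \<longleftrightarrow> sat A s p" if "range s \<subseteq> N" for p s
      using that
    proof (induction p arbitrary: s)
      case (Rel r ts)
      have "map (eval_tm (A\<lparr>univ := N\<rparr>) s) ts = map (eval_tm A s) ts" by simp
      then show ?case by (simp only: sat.simps) simp
    next
      case (Exists n p)
      have IH: "sat (A\<lparr>univ := N\<rparr>) (s(n := x)) p = sat A (s(n := x)) p" if "x \<in> N" for x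
        by (rule Exists.IH) (use Exists.prems that in auto)
      have "\<exists>x\<in>N. sat A (s(n := x)) p" if x: "x \<in> univ A" "sat A (s(n := x)) p" for x
      proof -
        obtain k where k: "\<And>s s'. (\<forall>i<k. s i = s' i) \<Longrightarrow> sat A s p = sat A s' p" using sat_cong by metis
        define l where "l = map s [0..<k]"
        have eq: "sat A ((asg l)(n := y)) p = sat A (s(n := y)) p" for y
          by (rule k) (simp add: asg_def l_def)
        have "wit l n p \<in> univ A \<and> sat A ((asg l)(n := wit l n p)) p"
          unfolding wit_def by (rule someI[of _ x]) (use x eq in auto)
        moreover have "l \<in> lists N" using Exists.prems by (auto simp: l_def in_lists_conv_set)
        moreover have "wit l n p \<in> Sk l" unfolding Sk_def by force
        ultimately have "wit l n p \<in> N" "sat A (s(n := wit l n p)) p" using cl[of l] eq by auto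
        then show ?thesis by blast
      qed
      then show ?case using IH N(1) by auto
    qed auto
    then show ?thesis using alg N(1) unfolding elem_sub_def by blast
  qed
  ultimately show ?thesis by (intro exI[of _ Sk]) blast
qed

section \<open>Reflection along continuous chains\<close>

text \<open>The chain argument in the abstract, with g \<alpha> for sup (X \<alpha> \<inter>
  \<kappa>) and z \<alpha> for X \<alpha> \<inter> \<omega>1. Indices start at a stage a at which
  \<kappa> has entered the chain, since only from then on is g \<alpha> guided into S. Continuity is
  asked strictly above a, as no index in I lies below a. The supremum has uncountable cofinality
  because countably many points below it lie below a single g \<gamma>.\<close>

lemma normal_sequence_eTr:
  fixes \<kappa> a :: "'v::zfc" and g z p :: "'v \<Rightarrow> 'v" and S :: "'v \<Rightarrow> 'v set"
  defines "I \<equiv> {\<alpha> \<in> elts omega1. elts a \<subseteq> elts \<alpha>}"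
  assumes r: "regular_cardinal \<kappa>" and w: "omega1 \<in> elts \<kappa>" and a: "a \<in> elts omega1"
    and S: "\<And>i. i \<in> elts omega1 \<Longrightarrow> S i \<subseteq> S_cof_omega \<kappa>"
    and p: "\<And>\<alpha>. \<alpha> \<in> elts omega1 \<Longrightarrow> p \<alpha> \<in> elts omega1"
    and fib: "\<And>i. i \<in> elts omega1 \<Longrightarrow> stationary_in {\<alpha> \<in> elts omega1. p \<alpha> = i} omega1"
    and z: "\<And>\<alpha>. \<alpha> \<in> elts omega1 \<Longrightarrow> z \<alpha> \<in> elts omega1"
    and z_inc: "\<And>\<alpha> \<beta>. \<beta> \<in> elts omega1 \<Longrightarrow> \<alpha> \<in> elts \<beta> \<Longrightarrow> z \<alpha> \<in> elts (z \<beta>)"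
    and z_cont: "\<And>\<beta>. \<beta> \<in> elts omega1 \<Longrightarrow> limit_ord \<beta> \<Longrightarrow> elts (z \<beta>) = (\<Union>\<alpha>\<in>elts \<beta>. elts (z \<alpha>))"
    and g: "\<And>\<alpha>. \<alpha> \<in> I \<Longrightarrow> g \<alpha> \<in> S (p (z \<alpha>))"
    and g_inc: "\<And>\<alpha> \<beta>. \<alpha> \<in> I \<Longrightarrow> \<beta> \<in> I \<Longrightarrow> \<alpha> \<in> elts \<beta> \<Longrightarrow> g \<alpha> \<in> elts (g \<beta>)"
    and g_cont: "\<And>\<beta>. \<beta> \<in> I \<Longrightarrow> limit_ord \<beta> \<Longrightarrow> a \<in> elts \<beta> \<Longrightarrow> elts (g \<beta>) = (\<Union>\<alpha>\<in>elts \<beta> \<inter> I. elts (g \<alpha>))"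
  shows "sup_ord (g ` I) \<in> eTr \<kappa> omega1 S"
proof -
  let ?w = "omega1 :: 'v"
  have ok: "Ord \<kappa>" using r regular_Ord by blast
  have ow: "Ord ?w" and lw: "limit_ord ?w" using Ord_omega1 regular_limit[OF regular_omega1] by auto
  have oI: "Ord \<alpha>" if "\<alpha> \<in> elts ?w" for \<alpha> using Ord_in_Ord[OF ow that] .
  have Iw: "\<alpha> \<in> elts ?w" if "\<alpha> \<in> I" for \<alpha> using that by (simp add: I_def)
  have I_up: "\<beta> \<in> I" if "\<alpha> \<in> I" "\<beta> \<in> elts ?w" "\<alpha> \<in> elts \<beta>" for \<alpha> \<beta>
    using that Ord_subset[OF oI[OF that(2)] that(3)] by (auto simp: I_def)
  have aI: "a \<in> I" using a by (simp add: I_def)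
  have gS: "g \<alpha> \<in> elts \<kappa>" "limit_ord (g \<alpha>)" if "\<alpha> \<in> I" for \<alpha>
  proof -
    have "g \<alpha> \<in> S_cof_omega \<kappa>" using g[OF that] S[OF p[OF z[OF Iw[OF that]]]] by blast
    then have "g \<alpha> \<in> elts \<kappa>" "cf (g \<alpha>) = omega" by (auto simp: S_cof_omega_def)
    then show "g \<alpha> \<in> elts \<kappa>" "limit_ord (g \<alpha>)" using cf_omega_limit(1) Ord_in_Ord[OF ok] by blast+
  qed
  have og: "Ord (g \<alpha>)" if "\<alpha> \<in> I" for \<alpha> using gS(2)[OF that] by (simp add: limit_ord_def)
  have g_rev: "\<alpha> \<in> elts \<beta>" if ab: "\<alpha> \<in> I" "\<beta> \<in> I" "g \<alpha> \<in> elts (g \<beta>)" for \<alpha> \<beta>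
  proof -
    consider "\<alpha> \<in> elts \<beta>" | "\<alpha> = \<beta>" | "\<beta> \<in> elts \<alpha>" using Ord_linear[OF oI[OF Iw[OF ab(1)]] oI[OF Iw[OF ab(2)]]] by blast
    then show ?thesis
    proof cases
      case 2
      then show ?thesis using ab(3) not_in_self by metis
    next
      case 3
      then show ?thesis using g_inc[OF ab(2,1)] ab(3) not_in_sym by blast
    qed
  qed
  define \<delta> where "\<delta> = sup_ord (g ` I)"
  have gI: "g ` I \<subseteq> elts \<kappa>" using gS(1) by blast
  have ed: "elts \<delta> = (\<Union>\<alpha>\<in>I. elts (g \<alpha>))" and od: "Ord \<delta>"
    using Ord_Union[OF small_subset[OF small_elts gI]] og unfolding \<delta>_def by auto
  have "g ` I \<lesssim> elts ?w"
    by (rule lepoll_trans[OF image_lepoll subset_imp_lepoll]) (auto simp: I_def)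
  from regular_bounded[OF r gI this w] obtain \<beta> where b: "\<beta> \<in> elts \<kappa>" "g ` I \<subseteq> elts \<beta>" by blast
  have "elts \<delta> \<subseteq> elts \<beta>" unfolding ed using b(2) Ord_trans[OF Ord_in_Ord[OF ok b(1)]] by blast
  then have dk: "\<delta> \<in> elts \<kappa>" using Ord_le_in_trans[OF ok od _ b(1)] by blast
  have nxt: "osucc \<alpha> \<in> I" if "\<alpha> \<in> I" for \<alpha>
    using I_up[OF that limit_ord_osucc[OF lw Iw[OF that]]] by simp
  have gd: "g \<alpha> \<in> elts \<delta>" if "\<alpha> \<in> I" for \<alpha>
    unfolding ed using g_inc[OF that nxt[OF that]] nxt[OF that] by auto
  have up: "\<exists>\<gamma>\<in>elts ?w. \<alpha> \<in> elts \<gamma> \<and> \<beta> \<in> elts \<gamma>" if "\<alpha> \<in> elts ?w" "\<beta> \<in> elts ?w" for \<alpha> \<beta>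
    by (rule limit_ord_two[OF lw that])
  have cbd: "\<exists>\<gamma>\<in>I. B \<subseteq> elts (g \<gamma>)" if B: "countable B" "B \<subseteq> elts \<delta>" for B
  proof -
    have "\<forall>b\<in>B. \<exists>\<alpha>. \<alpha> \<in> I \<and> b \<in> elts (g \<alpha>)" using B(2) unfolding ed by blast
    from bchoice[OF this] obtain c where c: "\<And>b. b \<in> B \<Longrightarrow> c b \<in> I \<and> b \<in> elts (g (c b))" by blast
    have "c ` B \<subseteq> elts ?w" using c Iw by blast
    from countable_bounded[OF regular_omega1 uncountable_omega1 this countable_image[OF B(1)]]
    obtain \<beta> where b: "\<beta> \<in> elts ?w" "c ` B \<subseteq> elts \<beta>" by blast
    obtain \<gamma> where gm: "\<gamma> \<in> elts ?w" "\<beta> \<in> elts \<gamma>" "a \<in> elts \<gamma>" using up[OF b(1) a] by blast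
    have gI: "\<gamma> \<in> I" by (rule I_up[OF aI gm(1,3)])
    have "x \<in> elts (g \<gamma>)" if x: "x \<in> B" for x
    proof -
      have "c x \<in> elts \<gamma>" using b(2) x Ord_trans[OF oI[OF gm(1)] gm(2)] by blast
      then have "g (c x) \<in> elts (g \<gamma>)" using g_inc gI c[OF x] by blast
      then show ?thesis using Ord_trans[OF og[OF gI]] c[OF x] by blast
    qed
    then show ?thesis using gI by blast
  qed
  have "omega \<in> elts (cf \<delta>)"
  proof (rule ccontr)
    assume n: "omega \<notin> elts (cf \<delta>)"
    obtain f where f: "cofinal_in (f ` elts (cf \<delta>)) \<delta>" using cf_least(2)[OF od] by blast
    have "elts (cf \<delta>) \<subseteq> elts omega" using n Ord_not_in_iff[OF Ord_omega cf_least(1)[OF od]] by blast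
    then have "countable (f ` elts (cf \<delta>))" using countable_subset[OF _ countable_omega] by blast
    moreover have "f ` elts (cf \<delta>) \<subseteq> elts \<delta>" using f by (simp add: cofinal_in_def)
    ultimately obtain \<gamma> where gm: "\<gamma> \<in> I" "f ` elts (cf \<delta>) \<subseteq> elts (g \<gamma>)" using cbd by blast
    obtain \<xi> where "\<xi> \<in> f ` elts (cf \<delta>)" "elts (g \<gamma>) \<subseteq> elts \<xi>"
      using f gd[OF gm(1)] unfolding cofinal_in_def by blast
    then show False using gm(2) not_in_self by blast
  qed
  moreover have "stationary_in (S i \<inter> elts \<delta>) \<delta>" if i: "i \<in> elts ?w" for i
  proof -
    have "S i \<inter> elts \<delta> \<inter> C \<noteq> {}" if C: "club_in C \<delta>" for C
    proof -
      have Cd: "C \<subseteq> elts \<delta>" and Cc: "\<And>\<alpha>. \<alpha> \<in> elts \<delta> \<Longrightarrow> \<exists>\<beta>\<in>C. elts \<alpha> \<subseteq> elts \<beta>"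
        and Cl: "\<And>\<alpha>. \<alpha> \<in> elts \<delta> \<Longrightarrow> limit_ord \<alpha> \<Longrightarrow> cofinal_in (C \<inter> elts \<alpha>) \<alpha> \<Longrightarrow> \<alpha> \<in> C"
        using C unfolding club_in_def cofinal_in_def by auto
      \<comment> \<open>\<open>h\<close> interleaves C with the range of g, dominates z and passes
        a. A closure point \<alpha> in the fibre of i is then a fixed point of z, which puts g
        \<alpha> into S i, and g \<alpha> is a limit of C.\<close>
      have "\<exists>\<gamma>\<in>elts ?w. z \<alpha> \<in> elts \<gamma> \<and> a \<in> elts \<gamma> \<and>
          (\<alpha> \<in> I \<longrightarrow> (\<exists>c\<in>C. elts (g \<alpha>) \<subseteq> elts c \<and> c \<in> elts (g \<gamma>)))" if al: "\<alpha> \<in> elts ?w" for \<alpha>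
      proof -
        obtain \<gamma>1 where g1: "\<gamma>1 \<in> elts ?w" "z \<alpha> \<in> elts \<gamma>1" "a \<in> elts \<gamma>1" using up[OF z[OF al] a] by blast
        show ?thesis
        proof (cases "\<alpha> \<in> I")
          case True
          obtain c where c: "c \<in> C" "elts (g \<alpha>) \<subseteq> elts c" using Cc[OF gd[OF True]] by blast
          obtain \<beta> where b: "\<beta> \<in> I" "c \<in> elts (g \<beta>)" using c(1) Cd ed by blast
          obtain \<gamma> where gm: "\<gamma> \<in> elts ?w" "\<gamma>1 \<in> elts \<gamma>" "\<beta> \<in> elts \<gamma>" using up[OF g1(1) Iw[OF b(1)]] by blast
          have gI: "\<gamma> \<in> I" by (rule I_up[OF b(1) gm(1,3)])
          have "c \<in> elts (g \<gamma>)" using Ord_trans[OF og[OF gI] g_inc[OF b(1) gI gm(3)] b(2)] .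
          moreover have "z \<alpha> \<in> elts \<gamma>" "a \<in> elts \<gamma>" using g1 Ord_trans[OF oI[OF gm(1)] gm(2)] by blast+
          ultimately show ?thesis using c gm(1) by blast
        next
          case False
          then show ?thesis using g1 by blast
        qed
      qed
      then obtain h where h: "\<And>\<alpha>. \<alpha> \<in> elts ?w \<Longrightarrow> h \<alpha> \<in> elts ?w \<and> z \<alpha> \<in> elts (h \<alpha>) \<and> a \<in> elts (h \<alpha>) \<and>
          (\<alpha> \<in> I \<longrightarrow> (\<exists>c\<in>C. elts (g \<alpha>) \<subseteq> elts c \<and> c \<in> elts (g (h \<alpha>))))" by metis
      obtain \<alpha> where al: "\<alpha> \<in> elts ?w" "p \<alpha> = i" "limit_ord \<alpha>" "\<And>\<beta>. \<beta> \<in> elts \<alpha> \<Longrightarrow> h \<beta> \<in> elts \<alpha>"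
        using stationary_closure_point[OF regular_omega1 uncountable_omega1 fib[OF i], of h] h by auto
      have inw: "\<beta> \<in> elts ?w" if "\<beta> \<in> elts \<alpha>" for \<beta> using Ord_trans[OF ow al(1) that] .
      have oa: "Ord \<alpha>" using oI[OF al(1)] .
      obtain \<beta>0 where "\<beta>0 \<in> elts \<alpha>" using al(3) by (auto simp: limit_ord_def)
      then have aa: "a \<in> elts \<alpha>" using h[OF inw] al(4) Ord_trans[OF oa] by blast
      then have aI': "\<alpha> \<in> I" by (rule I_up[OF aI al(1)])
      have zge: "elts \<beta> \<subseteq> elts (z \<beta>)" if "\<beta> \<in> elts ?w" for \<beta>
        using that
      proof (induction \<beta> rule: elts_induct)
        case (1 \<beta>)
        show ?case
        proof
          fix \<xi> assume x: "\<xi> \<in> elts \<beta>"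
          have xw: "\<xi> \<in> elts ?w" using Ord_trans[OF ow 1(2) x] .
          show "\<xi> \<in> elts (z \<beta>)"
            by (rule Ord_le_in_trans[OF oI[OF z[OF 1(2)]] oI[OF xw] 1(1)[OF x xw] z_inc[OF 1(2) x]])
        qed
      qed
      have "elts (z \<alpha>) \<subseteq> elts \<alpha>"
      proof
        fix \<xi> assume "\<xi> \<in> elts (z \<alpha>)"
        then obtain \<beta> where b: "\<beta> \<in> elts \<alpha>" "\<xi> \<in> elts (z \<beta>)" using z_cont[OF al(1,3)] by blast
        have "z \<beta> \<in> elts \<alpha>" using h[OF inw[OF b(1)]] Ord_trans[OF oa al(4)[OF b(1)]] by blast
        then show "\<xi> \<in> elts \<alpha>" using Ord_trans[OF oa] b(2) by blast
      qed
      then have "z \<alpha> = \<alpha>" using zge[OF al(1)] by (intro extensionality) blast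
      then have gi: "g \<alpha> \<in> S i" using g[OF aI'] al(2) by simp
      have "\<exists>c\<in>C \<inter> elts (g \<alpha>). elts \<xi> \<subseteq> elts c" if x: "\<xi> \<in> elts (g \<alpha>)" for \<xi>
      proof -
        obtain \<beta> where b: "\<beta> \<in> elts \<alpha>" "\<beta> \<in> I" "\<xi> \<in> elts (g \<beta>)" using x g_cont[OF aI' al(3) aa] by blast
        obtain c where c: "c \<in> C" "elts (g \<beta>) \<subseteq> elts c" "c \<in> elts (g (h \<beta>))" using h[OF inw[OF b(1)]] b(2) by blast
        have hw: "h \<beta> \<in> elts ?w" "a \<in> elts (h \<beta>)" using h[OF inw[OF b(1)]] by blast+
        have hI: "h \<beta> \<in> I" by (rule I_up[OF aI hw])
        have cg: "c \<in> elts (g \<alpha>)" using Ord_trans[OF og[OF aI'] g_inc[OF hI aI' al(4)[OF b(1)]] c(3)] .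
        have "Ord c" using Ord_in_Ord[OF og[OF aI'] cg] .
        then have "elts \<xi> \<subseteq> elts c" using Ord_subset b(3) c(2) by blast
        then show ?thesis using c(1) cg by blast
      qed
      then have "cofinal_in (C \<inter> elts (g \<alpha>)) (g \<alpha>)" unfolding cofinal_in_def by blast
      then have "g \<alpha> \<in> C" by (rule Cl[OF gd[OF aI'] gS(2)[OF aI']])
      then show ?thesis using gi gd[OF aI'] by blast
    qed
    then show ?thesis unfolding stationary_in_def by blast
  qed
  moreover have "club_in (g ` I) \<delta>"
  proof -
    have "\<exists>\<beta>\<in>g ` I. elts \<alpha> \<subseteq> elts \<beta>" if "\<alpha> \<in> elts \<delta>" for \<alpha>
      using that Ord_subset og unfolding ed by blast
    then have cof: "cofinal_in (g ` I) \<delta>" unfolding cofinal_in_def using gd by blast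
    have "\<gamma> \<in> g ` I" if gm: "\<gamma> \<in> elts \<delta>" "limit_ord \<gamma>" "cofinal_in (g ` I \<inter> elts \<gamma>) \<gamma>" for \<gamma>
    proof -
      have ogm: "Ord \<gamma>" using gm(2) by (simp add: limit_ord_def)
      obtain \<alpha>1 where a1: "\<alpha>1 \<in> I" "\<gamma> \<in> elts (g \<alpha>1)" using gm(1) ed by blast
      \<comment> \<open>The least index \<alpha> whose value is not below \<gamma> is a limit,
        because values of g are cofinal in \<gamma>; continuity then gives g \<alpha> =
        \<gamma>.\<close>
      define P where "P \<alpha> \<longleftrightarrow> \<alpha> \<in> I \<and> g \<alpha> \<notin> elts \<gamma>" for \<alpha>
      have "P \<alpha>1" using a1 not_in_sym P_def by blast
      define \<alpha> where "\<alpha> = least_ord P"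
      have al: "\<alpha> \<in> I" "g \<alpha> \<notin> elts \<gamma>" "\<And>\<beta>. \<beta> \<in> elts \<alpha> \<Longrightarrow> \<beta> \<in> I \<Longrightarrow> g \<beta> \<in> elts \<gamma>"
        using Ord_least[of \<alpha>1 P, OF oI[OF Iw[OF a1(1)]] \<open>P \<alpha>1\<close>] unfolding \<alpha>_def[symmetric] P_def by blast+
      have oa: "Ord \<alpha>" using oI[OF Iw[OF al(1)]] .
      have below: "\<beta> \<in> elts \<alpha>" if b: "\<beta> \<in> I" "g \<beta> \<in> elts \<gamma>" for \<beta>
      proof -
        have "\<alpha> \<noteq> \<beta>" using al(2) b(2) by blast
        moreover have "\<alpha> \<notin> elts \<beta>" using g_inc[OF al(1) b(1)] Ord_trans[OF ogm b(2)] al(2) by blast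
        ultimately show ?thesis using Ord_linear[OF oa oI[OF Iw[OF b(1)]]] by blast
      qed
      have next_above: "\<exists>\<beta>\<in>I. g \<beta> \<in> elts \<gamma> \<and> \<xi> \<in> elts (g \<beta>)" if "\<xi> \<in> elts \<gamma>" for \<xi>
        using cofinal_in_limit[OF gm(2,3) that] by blast
      obtain \<xi>0 where "\<xi>0 \<in> elts \<gamma>" using gm(2) by (auto simp: limit_ord_def)
      then obtain \<beta>0 where b0: "\<beta>0 \<in> I" "g \<beta>0 \<in> elts \<gamma>" using next_above by blast
      have aa: "a \<in> elts \<alpha>"
        using Ord_le_in_trans[OF oa oI[OF a] _ below[OF b0]] b0(1) by (simp add: I_def)
      have "\<exists>\<beta>'\<in>elts \<alpha>. \<beta> \<in> elts \<beta>'" if b: "\<beta> \<in> elts \<alpha>" for \<beta>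
      proof (cases "\<beta> \<in> I")
        case True
        obtain \<beta>' where b': "\<beta>' \<in> I" "g \<beta>' \<in> elts \<gamma>" "g \<beta> \<in> elts (g \<beta>')"
          using next_above[OF al(3)[OF b True]] by blast
        then show ?thesis using below[OF b'(1,2)] g_rev[OF True b'(1,3)] by blast
      next
        case False
        have "\<beta> \<in> elts ?w" using Ord_trans[OF ow Iw[OF al(1)] b] .
        then have "\<beta> \<in> elts a" using False Ord_not_in_iff[OF oI oI[OF a], of \<beta>] by (auto simp: I_def)
        then show ?thesis using aa by blast
      qed
      then have la: "limit_ord \<alpha>" unfolding limit_ord_def using oa aa by blast
      have "elts (g \<alpha>) \<subseteq> elts \<gamma>"
        unfolding g_cont[OF al(1) la aa] using al(3) Ord_trans[OF ogm] by blast
      moreover have "elts \<gamma> \<subseteq> elts (g \<alpha>)" using al(2) Ord_not_in_iff[OF og[OF al(1)] ogm] by blast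
      ultimately have "g \<alpha> = \<gamma>" by (intro extensionality) blast
      then show ?thesis using al(1) by blast
    qed
    then show ?thesis unfolding club_in_def using cof by blast
  qed
  moreover have "g ` I \<subseteq> elts \<delta> \<inter> (\<Union>i\<in>elts ?w. S i)"
    using gd g p z Iw by blast
  ultimately have "\<delta> \<in> eTr \<kappa> omega1 S" unfolding eTr_def using dk by blast
  then show ?thesis by (simp add: \<delta>_def)
qed

section \<open>Guided models and the application of SRP\<close>

lemma Ord_in_H:
  assumes o: "Ord \<alpha>" and "elts \<alpha> \<subseteq> elts \<mu>"
  shows "\<alpha> \<in> H (card_succ \<mu>)"
proof -
  have "y \<in> elts x" if "(y, x) \<in> {(a, b). a \<in> elts b}\<^sup>+" "Ord x" for x y :: 'a
    using that
  proof (induction rule: trancl_induct)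
    case (step b c)
    then show ?case using Ord_trans Ord_in_Ord by blast
  qed simp
  then have "trcl_elts \<alpha> \<subseteq> elts \<mu>" using assms unfolding trcl_elts_def by blast
  then have "trcl_elts \<alpha> \<prec> elts (card_succ \<mu>)"
    using card_succ_props(2) lesspoll_trans1 subset_imp_lepoll by blast
  then show ?thesis by (simp add: H_def)
qed

definition guided :: "'v::zfc set \<Rightarrow> ('v list \<Rightarrow> 'v set) \<Rightarrow> 'v set \<Rightarrow> ('v \<Rightarrow> 'v \<Rightarrow> 'v set) \<Rightarrow> ('v \<Rightarrow> 'v) \<Rightarrow> 'v set" where
  "guided A G K S p = {X \<in> ctbl_subsets A. (\<forall>l\<in>lists (elts X). G l \<inter> A \<subseteq> elts X) \<and>
     (\<forall>\<kappa>\<in>elts X \<inter> K. sup_ord (elts X \<inter> elts \<kappa>) \<in> S \<kappa> (p (set_of (elts X \<inter> elts omega1))))}"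

text \<open>T cut down to a fibre of p is imposed at \<omega>1, treated as one more cardinal, so
  that membership of X \<inter> \<omega>1 in T and the index i are prescribed together with the sets
  S \<kappa> i. The condition \<beta> \<subseteq> G [\<beta>] makes X \<inter> \<omega>1 an initial
  segment of \<omega>1, hence equal to the ordinal \<delta> in which it is cofinal.\<close>

lemma guided_projective_stationary:
  fixes K :: "'v::zfc set" and S :: "'v \<Rightarrow> 'v \<Rightarrow> 'v set"
  assumes KA: "insert omega1 K \<subseteq> H \<theta>" "\<And>\<kappa>. \<kappa> \<in> insert omega1 K \<Longrightarrow> elts \<kappa> \<subseteq> H \<theta>"
    and r: "\<And>\<kappa>. \<kappa> \<in> K \<Longrightarrow> regular_cardinal \<kappa>" and w: "\<And>\<kappa>. \<kappa> \<in> K \<Longrightarrow> omega1 \<in> elts \<kappa>"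
    and S: "\<And>\<kappa> i. \<kappa> \<in> K \<Longrightarrow> i \<in> elts omega1 \<Longrightarrow> S \<kappa> i \<subseteq> S_cof_omega \<kappa> \<and> stationary_in (S \<kappa> i) \<kappa>"
    and G: "\<And>l. countable (G l)" "\<And>\<beta>. \<beta> \<in> elts omega1 \<Longrightarrow> elts \<beta> \<subseteq> G [\<beta>]"
    and p: "\<And>T. stationary_in T omega1 \<Longrightarrow> \<exists>i\<in>elts omega1. stationary_in {\<alpha> \<in> T. p \<alpha> = i} omega1"
  shows "projective_stationary (guided (H \<theta>) G K S p) \<theta>"
proof -
  let ?w = "omega1 :: 'v"
  let ?P = "guided (H \<theta>) G K S p"
  have "{X \<in> ?P. set_of (elts X \<inter> elts ?w) \<in> T} \<inter> C \<noteq> {}"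
    if T: "stationary_in T ?w" and C: "club_ctbl C (H \<theta>)" for T C
  proof -
    obtain i where i: "i \<in> elts ?w" "stationary_in {\<alpha> \<in> T. p \<alpha> = i} ?w" using p[OF T] by blast
    define S' where "S' \<kappa> = (if \<kappa> = ?w then {\<alpha> \<in> T. p \<alpha> = i} else S \<kappa> i)" for \<kappa>
    have ne: "\<kappa> \<noteq> ?w" if "\<kappa> \<in> K" for \<kappa> using w[OF that] not_in_self by metis
    have r': "regular_cardinal \<kappa>" if "\<kappa> \<in> insert ?w K" for \<kappa> using that r regular_omega1 by blast
    have u': "uncountable (elts \<kappa>)" if "\<kappa> \<in> insert ?w K" for \<kappa>
      using that uncountable_regular[OF r w] uncountable_omega1 by blast
    have s': "stationary_in (S' \<kappa>) \<kappa>" if "\<kappa> \<in> insert ?w K" for \<kappa>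
      using that i S unfolding S'_def by auto
    have c': "\<exists>E. countable E \<and> cofinal_in E \<delta>" if k: "\<kappa> \<in> insert ?w K" and d: "\<delta> \<in> S' \<kappa>" for \<kappa> \<delta>
    proof (cases "\<kappa> = ?w")
      case True
      then have "\<delta> \<in> elts ?w" using s'[OF k] d unfolding stationary_in_def by blast
      then show ?thesis by (intro exI[of _ "elts \<delta>"]) (auto simp: countable_in_omega1 cofinal_in_def)
    next
      case False
      then have "\<kappa> \<in> K" "\<delta> \<in> S \<kappa> i" using k d by (auto simp: S'_def)
      then have "\<delta> \<in> elts \<kappa>" "cf \<delta> = omega" using S[OF _ i(1), of \<kappa>] by (auto simp: S_cof_omega_def)
      moreover have "Ord \<kappa>" using r'[OF k] regular_Ord by blast
      ultimately show ?thesis using cf_omega_limit(2) Ord_in_Ord by blast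
    qed
    have "\<exists>X\<in>C. ?w \<in> elts X \<and> (\<forall>l\<in>lists (elts X). G l \<inter> H \<theta> \<subseteq> elts X) \<and>
        (\<forall>\<kappa>\<in>elts X \<inter> insert ?w K. \<exists>\<delta>\<in>S' \<kappa>. limit_ord \<delta> \<and> cofinal_in (elts X \<inter> elts \<kappa>) \<delta>)"
      by (rule cofinality_omega_mutually_stationary[OF C insertI1 KA r' u' s' c' G(1)])
    then obtain X where X: "X \<in> C" "?w \<in> elts X" "\<And>l. l \<in> lists (elts X) \<Longrightarrow> G l \<inter> H \<theta> \<subseteq> elts X"
      and Xk: "\<And>\<kappa>. \<kappa> \<in> elts X \<inter> insert ?w K \<Longrightarrow> \<exists>\<delta>\<in>S' \<kappa>. limit_ord \<delta> \<and> cofinal_in (elts X \<inter> elts \<kappa>) \<delta>"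
      by blast
    have Xc: "X \<in> ctbl_subsets (H \<theta>)" using C X(1) by (auto simp: club_ctbl_def)
    obtain \<delta> where d: "\<delta> \<in> T" "p \<delta> = i" "limit_ord \<delta>" "cofinal_in (elts X \<inter> elts ?w) \<delta>"
      using Xk[of ?w] X(2) by (auto simp: S'_def)
    have "\<xi> \<in> elts X \<inter> elts ?w" if x: "\<xi> \<in> elts \<delta>" for \<xi>
    proof -
      obtain \<beta> where b: "\<beta> \<in> elts X" "\<beta> \<in> elts ?w" "\<xi> \<in> elts \<beta>" using cofinal_in_limit[OF d(3,4) x] by blast
      have xw: "\<xi> \<in> elts ?w" using Ord_trans[OF Ord_omega1 b(2,3)] .
      then have "\<xi> \<in> H \<theta>" using KA(2)[of ?w] by blast
      then show ?thesis using X(3)[of "[\<beta>]"] G(2)[OF b(2)] b xw by auto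
    qed
    then have "elts X \<inter> elts ?w = elts \<delta>" using d(4) unfolding cofinal_in_def by blast
    then have eq: "set_of (elts X \<inter> elts ?w) = \<delta>" by simp
    have "sup_ord (elts X \<inter> elts \<kappa>) \<in> S \<kappa> i" if k: "\<kappa> \<in> elts X \<inter> K" for \<kappa>
      using Xk[of \<kappa>] k ne[of \<kappa>] cofinal_in_sup unfolding S'_def by auto
    then have "X \<in> ?P" unfolding guided_def using Xc X(3) eq d(2) by auto
    then show ?thesis using eq d(1) X(1) by auto
  qed
  moreover have "?P \<subseteq> ctbl_subsets (H \<theta>)" unfolding guided_def by blast
  ultimately show ?thesis unfolding projective_stationary_def stationary_ctbl_def by blast
qed

theorem theorem3p27:
  fixes K :: "'v::zfc" and S :: "'v \<Rightarrow> 'v \<Rightarrow> 'v set"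
  assumes "SRP TYPE('v)"
    and "elts K \<noteq> {}"
    and "\<forall>\<kappa>\<in>elts K. regular_cardinal \<kappa>"
    and "omega1 \<in> elts (least_ord (\<lambda>\<kappa>. \<kappa> \<in> elts K))"
    and "\<forall>\<kappa>\<in>elts K. \<forall>i\<in>elts omega1. S \<kappa> i \<subseteq> S_cof_omega \<kappa> \<and> stationary_in (S \<kappa> i) \<kappa>"
  shows "mutually_stationary K (\<lambda>\<kappa>. eTr \<kappa> omega1 (S \<kappa>))"
proof -
  let ?w = "omega1 :: 'v"
  note S = assms(5)[rule_format]
  have r: "regular_cardinal \<kappa>" if "\<kappa> \<in> elts K" for \<kappa> using assms(3) that by blast
  have oK: "Ord \<kappa>" if "\<kappa> \<in> elts K" for \<kappa> using r[OF that] regular_Ord by blast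
  have w: "?w \<in> elts \<kappa>" if "\<kappa> \<in> elts K" for \<kappa>
    using Ord_least[of \<kappa> "\<lambda>\<kappa>. \<kappa> \<in> elts K", OF oK[OF that] that] assms(4) by blast
  obtain \<kappa>0 where k0: "\<kappa>0 \<in> elts K" using assms(2) by blast
  have ow: "Ord ?w" by (rule Ord_omega1)
  obtain p where p: "\<And>\<alpha>. \<alpha> \<in> elts ?w \<Longrightarrow> p \<alpha> \<in> elts ?w"
      "\<And>i. i \<in> elts ?w \<Longrightarrow> stationary_in {\<alpha> \<in> elts ?w. p \<alpha> = i} ?w"
      "\<And>T. stationary_in T ?w \<Longrightarrow> \<exists>i\<in>elts ?w. stationary_in {\<alpha> \<in> T. p \<alpha> = i} ?w"
    using ex_stationary_partition[where 'v = 'v] by blast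
  define \<Delta> where "\<Delta> = sup_ord (elts K)"
  have eD: "elts \<Delta> = (\<Union>\<kappa>\<in>elts K. elts \<kappa>)" and oD: "Ord \<Delta>"
    using Ord_Union[OF small_elts oK] unfolding \<Delta>_def by auto
  \<comment> \<open>\<theta> will be the successor of \<mu>, hence regular. It is at least
    \<omega>2, as \<open>SRP\<close> requires, and so large that K and all ordinals below \<Delta>
    lie in H \<theta>.\<close>
  define \<mu> where "\<mu> = sup_ord {\<Delta>, omega2}"
  have "small {\<Delta>, omega2}" by (rule small_countable) simp
  moreover have "Ord omega2" unfolding omega2_def by (rule card_succ_props)
  ultimately have em: "elts \<mu> = elts \<Delta> \<union> elts omega2" and om: "Ord \<mu>"
    using Ord_Union[of "{\<Delta>, omega2}"] oD unfolding \<mu>_def by auto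
  define \<theta> where "\<theta> = card_succ \<mu>"
  have kD: "elts \<kappa> \<subseteq> elts \<Delta>" if "\<kappa> \<in> elts K" for \<kappa> using that eD by blast
  have "infinite (elts \<kappa>0)" using r[OF k0] by (simp add: regular_cardinal_def)
  then have "infinite (elts \<mu>)" using kD[OF k0] em finite_subset by auto
  then have rt: "regular_cardinal \<theta>" unfolding \<theta>_def by (rule regular_card_succ)
  have "\<mu> \<in> elts \<theta>" unfolding \<theta>_def by (rule in_card_succ[OF om])
  then have mt: "elts \<mu> \<subseteq> elts \<theta>" using Ord_subset[OF regular_Ord[OF rt]] by blast
  have inH: "\<alpha> \<in> H \<theta>" if "Ord \<alpha>" "elts \<alpha> \<subseteq> elts \<Delta>" for \<alpha>
    unfolding \<theta>_def using that em by (intro Ord_in_H) auto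
  have DH: "\<alpha> \<in> H \<theta>" if "\<alpha> \<in> elts \<Delta>" for \<alpha>
    by (rule inH[OF Ord_in_Ord[OF oD that] Ord_subset[OF oD that]])
  have wD: "?w \<in> elts \<Delta>" using kD[OF k0] w[OF k0] by blast
  have KA: "insert ?w (elts K) \<subseteq> H \<theta>" using DH[OF wD] inH oK kD by blast
  have KA': "elts \<kappa> \<subseteq> H \<theta>" if "\<kappa> \<in> insert ?w (elts K)" for \<kappa>
    using that kD Ord_subset[OF oD wD] DH by blast
  have "\<exists>N. elem_sub N A \<and> (\<forall>\<kappa>\<in>N \<inter> elts K. sup_ord (N \<inter> elts \<kappa>) \<in> eTr \<kappa> omega1 (S \<kappa>))"
    if A: "is_algebra A" "univ A = elts \<Delta>" for A
  proof -
    obtain Sk where Sk: "\<forall>l. countable (Sk l)"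
      "\<forall>N. N \<subseteq> univ A \<and> N \<noteq> {} \<and> (\<forall>l\<in>lists N. Sk l \<inter> univ A \<subseteq> N) \<longrightarrow> elem_sub N A"
      using ex_skolem_functions[OF A(1)] by (elim exE conjE)
    \<comment> \<open>Besides the Skolem functions: \<omega>1 belongs to every model; at the list
      [X \<alpha>] the second item puts X \<alpha> \<inter> \<omega>1 into later models; at
      [X \<alpha>, \<kappa>] the third puts in the successor of sup (X \<alpha> \<inter> \<kappa>),
      because the supremum itself would only give a weak inequality between suprema. Adding the
      members of countable elements turns X \<alpha> \<in> X \<beta> into inclusion and makes X
      \<alpha> \<inter> \<omega>1 an ordinal.\<close>
    define G where "G l = Sk l \<union> {?w, set_of (elts (hd l) \<inter> elts ?w), osucc (sup_ord (elts (hd l) \<inter> elts (last l)))}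
        \<union> (if countable (elts (hd l)) then elts (hd l) else {})" for l
    let ?P = "guided (H \<theta>) G (elts K) S p"
    have "countable (G l)" for l using Sk(1) by (simp add: G_def)
    moreover have "elts \<beta> \<subseteq> G [\<beta>]" if "\<beta> \<in> elts ?w" for \<beta>
      using countable_in_omega1[OF that] by (auto simp: G_def)
    ultimately have "projective_stationary ?P \<theta>"
      by (intro guided_projective_stationary KA KA' r w S p(3))
    moreover have "elts omega2 \<subseteq> elts \<theta>" using mt em by blast
    ultimately have "regular_cardinal \<theta> \<and> elts omega2 \<subseteq> elts \<theta> \<and> projective_stationary ?P \<theta>"
      using rt by blast
    from assms(1)[unfolded SRP_def, rule_format, OF this]
    obtain X where X: "continuous_in_chain X ?w" "\<And>\<alpha>. \<alpha> \<in> elts ?w \<Longrightarrow> X \<alpha> \<in> ?P"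
      by blast
    have XA: "elts (X \<alpha>) \<subseteq> H \<theta>" "countable (elts (X \<alpha>))" if "\<alpha> \<in> elts ?w" for \<alpha>
      using X(2)[OF that] by (auto simp: guided_def ctbl_subsets_def)
    have XG: "x \<in> elts (X \<alpha>)" if "\<alpha> \<in> elts ?w" "set l \<subseteq> elts (X \<alpha>)" "x \<in> G l" "x \<in> H \<theta>" for \<alpha> l x
      using X(2)[OF that(1)] that by (auto simp: guided_def in_lists_conv_set subset_iff)
    have XS: "sup_ord (elts (X \<alpha>) \<inter> elts \<kappa>) \<in> S \<kappa> (p (set_of (elts (X \<alpha>) \<inter> elts ?w)))"
      if "\<alpha> \<in> elts ?w" "\<kappa> \<in> elts (X \<alpha>)" "\<kappa> \<in> elts K" for \<alpha> \<kappa>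
      using X(2)[OF that(1)] that by (auto simp: guided_def)
    have Xin: "X \<alpha> \<in> elts (X \<beta>)" if "\<beta> \<in> elts ?w" "\<alpha> \<in> elts \<beta>" for \<alpha> \<beta>
      using X(1) that by (auto simp: continuous_in_chain_def)
    have Xlim: "elts (X \<beta>) = (\<Union>\<alpha>\<in>elts \<beta>. elts (X \<alpha>))" if "\<beta> \<in> elts ?w" "limit_ord \<beta>" for \<beta>
      using X(1) that by (auto simp: continuous_in_chain_def)
    have below_w: "\<alpha> \<in> elts ?w" if "\<beta> \<in> elts ?w" "\<alpha> \<in> elts \<beta>" for \<alpha> \<beta> using Ord_trans[OF ow that] .
    have Xmono: "elts (X \<alpha>) \<subseteq> elts (X \<beta>)" if "\<beta> \<in> elts ?w" "\<alpha> \<in> elts \<beta>" for \<alpha> \<beta>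
    proof
      fix x assume x: "x \<in> elts (X \<alpha>)"
      have aw: "\<alpha> \<in> elts ?w" using below_w that by blast
      show "x \<in> elts (X \<beta>)"
        by (rule XG[OF that(1), of "[X \<alpha>]"]) (use Xin[OF that] XA[OF aw] x in \<open>auto simp: G_def\<close>)
    qed
    have Xmono': "elts (X \<alpha>) \<subseteq> elts (X \<beta>)" if "\<beta> \<in> elts ?w" "\<alpha> \<in> elts ?w" "elts \<alpha> \<subseteq> elts \<beta>" for \<alpha> \<beta>
      using Xmono that Ord_subset_iff Ord_in_Ord[OF ow] by blast
    have wX: "?w \<in> elts (X \<alpha>)" if "\<alpha> \<in> elts ?w" for \<alpha>
      by (rule XG[OF that, of "[]"]) (use KA in \<open>auto simp: G_def\<close>)
    define z where "z \<alpha> = set_of (elts (X \<alpha>) \<inter> elts ?w)" for \<alpha>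
    have ez: "elts (z \<alpha>) = elts (X \<alpha>) \<inter> elts ?w" for \<alpha>
      unfolding z_def by (rule elts_set_of[OF small_subset[OF small_elts]]) blast
    have zw: "z \<alpha> \<in> elts ?w" if a: "\<alpha> \<in> elts ?w" for \<alpha>
    proof (rule in_omega1I)
      show "countable (elts (z \<alpha>))" unfolding ez using XA(2)[OF a] by blast
      show "Ord (z \<alpha>)"
      proof (rule OrdI)
        fix \<beta> assume b: "\<beta> \<in> elts (z \<alpha>)"
        then have bw: "\<beta> \<in> elts ?w" "\<beta> \<in> elts (X \<alpha>)" by (auto simp: ez)
        then show "Ord \<beta>" using Ord_in_Ord[OF ow] by blast
        show "\<gamma> \<in> elts (z \<alpha>)" if g: "\<gamma> \<in> elts \<beta>" for \<gamma>
        proof -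
          have gw: "\<gamma> \<in> elts ?w" using below_w[OF bw(1) g] .
          then have "\<gamma> \<in> H \<theta>" using KA' by blast
          then have "\<gamma> \<in> elts (X \<alpha>)"
            using XG[OF a, of "[\<beta>]" \<gamma>] bw(2) g countable_in_omega1[OF bw(1)] by (auto simp: G_def)
          then show ?thesis using gw by (simp add: ez)
        qed
      qed
    qed
    have z_inc: "z \<alpha> \<in> elts (z \<beta>)" if b: "\<beta> \<in> elts ?w" and a: "\<alpha> \<in> elts \<beta>" for \<alpha> \<beta>
    proof -
      have za: "z \<alpha> \<in> elts ?w" by (rule zw[OF below_w[OF b a]])
      have "z \<alpha> \<in> elts (X \<beta>)"
        by (rule XG[OF b, of "[X \<alpha>]"]) (use Xin[OF b a] za KA' in \<open>auto simp: G_def z_def\<close>)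
      then show ?thesis using za by (simp add: ez)
    qed
    have z_cont: "elts (z \<beta>) = (\<Union>\<alpha>\<in>elts \<beta>. elts (z \<alpha>))" if "\<beta> \<in> elts ?w" "limit_ord \<beta>" for \<beta>
      unfolding ez Xlim[OF that] by blast
    \<comment> \<open>The chain lives in H \<theta> but the algebra on \<Delta>. Every \<kappa>
      \<in> K is a subset of \<Delta>, so this cut does not change the trace on \<kappa>.\<close>
    define N where "N = (\<Union>\<alpha>\<in>elts ?w. elts (X \<alpha>)) \<inter> elts \<Delta>"
    have "elem_sub N A"
    proof (intro Sk(2)[rule_format] conjI ballI)
      show "N \<subseteq> univ A" unfolding N_def A(2) by blast
      have "omega \<in> elts ?w" by (rule omega_in_omega1)
      then show "N \<noteq> {}" using wX wD unfolding N_def by blast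
      fix l assume "l \<in> lists N"
      then have "l \<in> lists (\<Union>\<alpha>\<in>elts ?w. elts (X \<alpha>))" unfolding N_def by auto
      moreover have "\<exists>\<gamma>\<in>elts ?w. elts (X \<alpha>) \<union> elts (X \<beta>) \<subseteq> elts (X \<gamma>)" if "\<alpha> \<in> elts ?w" "\<beta> \<in> elts ?w" for \<alpha> \<beta>
        using limit_ord_two[OF regular_limit[OF regular_omega1] that] Xmono by blast
      ultimately obtain \<alpha> where a: "\<alpha> \<in> elts ?w" "l \<in> lists (elts (X \<alpha>))"
        using lists_directed_UN[of l "\<lambda>\<alpha>. elts (X \<alpha>)" "elts ?w"] \<open>omega \<in> elts ?w\<close> by blast
      have "x \<in> elts (X \<alpha>)" if "x \<in> Sk l" "x \<in> elts \<Delta>" for x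
        by (rule XG[OF a(1), of l]) (use a(2) that DH in \<open>auto simp: G_def in_lists_conv_set\<close>)
      then show "Sk l \<inter> univ A \<subseteq> N" unfolding N_def A(2) using a(1) by blast
    qed
    moreover have "sup_ord (N \<inter> elts \<kappa>) \<in> eTr \<kappa> omega1 (S \<kappa>)" if k: "\<kappa> \<in> N \<inter> elts K" for \<kappa>
    proof -
      have kK: "\<kappa> \<in> elts K" using k by blast
      obtain a where a: "a \<in> elts ?w" "\<kappa> \<in> elts (X a)" using k unfolding N_def by blast
      define I where "I = {\<alpha> \<in> elts ?w. elts a \<subseteq> elts \<alpha>}"
      define g where "g \<alpha> = sup_ord (elts (X \<alpha>) \<inter> elts \<kappa>)" for \<alpha>
      have eg: "elts (g \<alpha>) = (\<Union>x\<in>elts (X \<alpha>) \<inter> elts \<kappa>. elts x)" for \<alpha>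
        unfolding g_def by (rule elts_sup_ord[OF small_subset[OF small_elts]])
          (use Ord_in_Ord[OF oK[OF kK]] in auto)
      have kX: "\<kappa> \<in> elts (X \<alpha>)" if "\<alpha> \<in> I" for \<alpha>
        using that a Xmono'[of \<alpha> a] by (auto simp: I_def)
      have gS: "g \<alpha> \<in> S \<kappa> (p (z \<alpha>))" if "\<alpha> \<in> I" for \<alpha>
        using XS[OF _ kX[OF that] kK] that unfolding g_def z_def I_def by blast
      have gk: "g \<alpha> \<in> elts \<kappa>" if "\<alpha> \<in> I" for \<alpha>
        using gS[OF that] S[OF kK p(1)[OF zw]] that unfolding I_def S_cof_omega_def by blast
      have g_inc: "g \<alpha> \<in> elts (g \<beta>)" if al: "\<alpha> \<in> I" and be: "\<beta> \<in> I" and ab: "\<alpha> \<in> elts \<beta>" for \<alpha> \<beta>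
      proof -
        have bw: "\<beta> \<in> elts ?w" using be by (simp add: I_def)
        have sk: "osucc (g \<alpha>) \<in> elts \<kappa>" by (rule limit_ord_osucc[OF regular_limit[OF r[OF kK]] gk[OF al]])
        have "osucc (g \<alpha>) \<in> elts (X \<beta>)"
          by (rule XG[OF bw, of "[X \<alpha>, \<kappa>]"]) (use Xin[OF bw ab] kX[OF be] sk KA' kK in \<open>auto simp: G_def g_def\<close>)
        then show ?thesis unfolding eg using sk by (intro UN_I[of "osucc (g \<alpha>)"]) auto
      qed
      have g_cont: "elts (g \<beta>) = (\<Union>\<alpha>\<in>elts \<beta> \<inter> I. elts (g \<alpha>))"
        if be: "\<beta> \<in> I" and l: "limit_ord \<beta>" and ab: "a \<in> elts \<beta>" for \<beta>
      proof -
        have bw: "\<beta> \<in> elts ?w" using be by (simp add: I_def)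
        have "elts (X \<beta>) = (\<Union>\<alpha>\<in>elts \<beta> \<inter> I. elts (X \<alpha>))"
        proof
          show "elts (X \<beta>) \<subseteq> (\<Union>\<alpha>\<in>elts \<beta> \<inter> I. elts (X \<alpha>))"
          proof
            fix x assume "x \<in> elts (X \<beta>)"
            then obtain \<alpha> where al: "\<alpha> \<in> elts \<beta>" "x \<in> elts (X \<alpha>)" using Xlim[OF bw l] by blast
            obtain \<gamma> where g: "\<gamma> \<in> elts \<beta>" "\<alpha> \<in> elts \<gamma>" "a \<in> elts \<gamma>" using limit_ord_two[OF l al(1) ab] by blast
            have gw: "\<gamma> \<in> elts ?w" using below_w[OF bw g(1)] .
            have "\<gamma> \<in> I" using gw Ord_subset[OF Ord_in_Ord[OF ow gw] g(3)] by (simp add: I_def)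
            then show "x \<in> (\<Union>\<alpha>\<in>elts \<beta> \<inter> I. elts (X \<alpha>))" using Xmono[OF gw g(2)] al(2) g(1) by blast
          qed
        qed (use Xmono[OF bw] in blast)
        then show ?thesis unfolding eg by blast
      qed
      have "sup_ord (g ` I) \<in> eTr \<kappa> omega1 (S \<kappa>)"
        unfolding I_def
      proof (rule normal_sequence_eTr[OF r[OF kK] w[OF kK] a(1), of "S \<kappa>" p z g])
        show "S \<kappa> i \<subseteq> S_cof_omega \<kappa>" if "i \<in> elts ?w" for i using S[OF kK that] by blast
      qed (use p zw z_inc z_cont gS g_inc g_cont in \<open>auto simp: I_def\<close>)
      moreover have "sup_ord (N \<inter> elts \<kappa>) = sup_ord (g ` I)"
      proof (rule extensionality)
        have 1: "elts (sup_ord (N \<inter> elts \<kappa>)) = (\<Union>x\<in>N \<inter> elts \<kappa>. elts x)"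
          by (rule elts_sup_ord[OF small_subset[OF small_elts]]) (use Ord_in_Ord[OF oK[OF kK]] in auto)
        have 2: "elts (sup_ord (g ` I)) = (\<Union>x\<in>g ` I. elts x)"
          by (rule elts_sup_ord[OF small_subset[OF small_elts[of \<kappa>]]]) (use gk Ord_in_Ord[OF oK[OF kK]] in auto)
        have "(\<Union>\<alpha>\<in>elts ?w. elts (X \<alpha>)) = (\<Union>\<alpha>\<in>I. elts (X \<alpha>))"
        proof
          show "(\<Union>\<alpha>\<in>elts ?w. elts (X \<alpha>)) \<subseteq> (\<Union>\<alpha>\<in>I. elts (X \<alpha>))"
          proof
            fix x assume "x \<in> (\<Union>\<alpha>\<in>elts ?w. elts (X \<alpha>))"
            then obtain \<alpha> where al: "\<alpha> \<in> elts ?w" "x \<in> elts (X \<alpha>)" by blast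
            obtain \<gamma> where g: "\<gamma> \<in> elts ?w" "\<alpha> \<in> elts \<gamma>" "a \<in> elts \<gamma>"
              using limit_ord_two[OF regular_limit[OF regular_omega1] al(1) a(1)] by blast
            have "\<gamma> \<in> I" using g(1) Ord_subset[OF Ord_in_Ord[OF ow g(1)] g(3)] by (simp add: I_def)
            then show "x \<in> (\<Union>\<alpha>\<in>I. elts (X \<alpha>))" using Xmono[OF g(1,2)] al(2) by blast
          qed
        qed (auto simp: I_def)
        then have "N \<inter> elts \<kappa> = (\<Union>\<alpha>\<in>I. elts (X \<alpha>)) \<inter> elts \<kappa>" unfolding N_def using kD[OF kK] by blast
        then show "elts (sup_ord (N \<inter> elts \<kappa>)) = elts (sup_ord (g ` I))"
          unfolding 1 2 by (auto simp: eg)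
      qed
      ultimately show ?thesis by simp
    qed
    ultimately show ?thesis by blast
  qed
  then show ?thesis unfolding mutually_stationary_def \<Delta>_def using r by (auto simp: eTr_def)
qed

end
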